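(* Let $M$ be a Turing machine over the binary input alphabet, and for a binary input string $s$ let $\|s\|$ denote its length. Suppose there is a number $K$ such that for every input $s$ with $\|s\|\ge K$ we have $t_M(\|s\|)<\|s\|$. Then for every input $r$ with $\|r\|\ge K$, the machine $M$ halts on $r$ in fewer than $K$ steps. Moreover, if $M(s)=1$ for every input $s$ with $\|s\|\le K$, then the statement $\forall s\,(M(s)=1)$ can be proved in ZFC.
   Context: A Turing machine is a tuple $M=(Q,\Gamma,\delta,q_0,q_{halt})$ with finite state set $Q$, tape alphabet $\Gamma=\{0,1,\sqcup,\triangleright\}$ ($\sqcup$ the blank, $\triangleright$ a left-end marker that is never overwritten and from which the head always moves right), transition function $\delta:Q\times\Gamma\to Q\times\Gamma\times\{L,S,R\}$, start state $q_0$ and halting state $q_{halt}$ (with $\delta(q_{halt},a)=(q_{halt},a,S)$ for all $a$). For a machine halting on all inputs, its time complexity $t_M:\omega\to\omega$ is given by $t_M(n)=$ the maximum number of steps $M$ uses on any input of length $n$. *)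

theory Defs
  imports Main
begin

section \<open>Turing machines\<close>

datatype sym = Zero | One | Blank | Mark

datatype dir = MoveL | MoveS | MoveR

record 'q tm =
  states :: "'q set"
  delta :: "'q \<Rightarrow> sym \<Rightarrow> 'q \<times> sym \<times> dir"
  start :: 'q
  halt :: 'q

text \<open>The condition at the left-end marker is only imposed outside the halting state, whose
  transitions are all stationary.\<close>

definition turing_machine :: "'q tm \<Rightarrow> bool" where
  "turing_machine M \<longleftrightarrow>
     finite (states M) \<and> start M \<in> states M \<and> halt M \<in> states M \<and>
     (\<forall>q\<in>states M. \<forall>a. fst (delta M q a) \<in> states M) \<and>
     (\<forall>q\<in>states M. q \<noteq> halt M \<longrightarrow> (\<exists>q'. delta M q Mark = (q', Mark, MoveR))) \<and>
     (\<forall>a. delta M (halt M) a = (halt M, a, MoveS))"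

text \<open>A configuration consists of the state, the head position and the tape contents. Cell 0
  holds the left-end marker and the input starts in cell 1; the head starts in cell 0. In a
  run of a \<open>turing_machine\<close> the head never moves left from cell 0.\<close>

type_synonym 'q config = "'q \<times> nat \<times> (nat \<Rightarrow> sym)"

fun move :: "dir \<Rightarrow> nat \<Rightarrow> nat" where
  "move MoveL h = h - 1"
| "move MoveS h = h"
| "move MoveR h = h + 1"

fun step :: "'q tm \<Rightarrow> 'q config \<Rightarrow> 'q config" where
  "step M (q, h, t) = (case delta M q (t h) of (q', b, m) \<Rightarrow> (q', move m h, t(h := b)))"

definition initial_tape :: "bool list \<Rightarrow> nat \<Rightarrow> sym" where
  "initial_tape s i =
     (if i = 0 then Mark
      else if i \<le> length s then (if s ! (i - 1) then One else Zero)
      else Blank)"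

definition run :: "'q tm \<Rightarrow> bool list \<Rightarrow> nat \<Rightarrow> 'q config" where
  "run M s n = (step M ^^ n) (start M, 0, initial_tape s)"

definition halts_at :: "'q tm \<Rightarrow> bool list \<Rightarrow> nat \<Rightarrow> bool" where
  "halts_at M s n \<longleftrightarrow> fst (run M s n) = halt M"

definition halts_on_all_inputs :: "'q tm \<Rightarrow> bool" where
  "halts_on_all_inputs M \<longleftrightarrow> (\<forall>s. \<exists>n. halts_at M s n)"

definition steps :: "'q tm \<Rightarrow> bool list \<Rightarrow> nat" where
  "steps M s = (LEAST n. halts_at M s n)"

definition time_complexity :: "'q tm \<Rightarrow> nat \<Rightarrow> nat" where
  "time_complexity M n = Max {steps M s | s. length s = n}"

text \<open>The output is the longest binary word starting in cell 1.\<close>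

definition tape_output :: "(nat \<Rightarrow> sym) \<Rightarrow> bool list" where
  "tape_output t = map (\<lambda>i. t i = One) [1..<(LEAST k. 1 \<le> k \<and> t k \<notin> {Zero, One})]"

definition outputs :: "'q tm \<Rightarrow> bool list \<Rightarrow> bool list \<Rightarrow> bool" where
  "outputs M s w \<longleftrightarrow> (\<exists>n. halts_at M s n \<and> tape_output (snd (snd (run M s n))) = w)"


section \<open>First-order logic of set theory\<close>

text \<open>Variables are de Bruijn indices; there are no other terms.\<close>

datatype fm = Mem nat nat | Eq nat nat | Bot | Imp fm fm | All fm

definition Neg :: "fm \<Rightarrow> fm" where "Neg p = Imp p Bot"
definition Or :: "fm \<Rightarrow> fm \<Rightarrow> fm" where "Or p q = Imp (Neg p) q"
definition And :: "fm \<Rightarrow> fm \<Rightarrow> fm" where "And p q = Neg (Imp p (Neg q))"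
definition Iff :: "fm \<Rightarrow> fm \<Rightarrow> fm" where "Iff p q = And (Imp p q) (Imp q p)"
definition Ex :: "fm \<Rightarrow> fm" where "Ex p = Neg (All (Neg p))"

definition BAll :: "nat \<Rightarrow> fm \<Rightarrow> fm" where "BAll x p = All (Imp (Mem 0 (x + 1)) p)"
definition BEx :: "nat \<Rightarrow> fm \<Rightarrow> fm" where "BEx x p = Ex (And (Mem 0 (x + 1)) p)"

definition Conj :: "fm list \<Rightarrow> fm" where "Conj ps = foldr And ps (Neg Bot)"
definition Disj :: "fm list \<Rightarrow> fm" where "Disj ps = foldr Or ps Bot"

primrec rename :: "fm \<Rightarrow> (nat \<Rightarrow> nat) \<Rightarrow> fm" where
  "rename (Mem x y) r = Mem (r x) (r y)"
| "rename (Eq x y) r = Eq (r x) (r y)"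
| "rename Bot r = Bot"
| "rename (Imp p q) r = Imp (rename p r) (rename q r)"
| "rename (All p) r = All (rename p (case_nat 0 (\<lambda>k. Suc (r k))))"

definition lift :: "fm \<Rightarrow> fm" where "lift p = rename p Suc"

definition inst :: "nat \<Rightarrow> fm \<Rightarrow> fm" where "inst x p = rename p (case_nat x (\<lambda>k. k))"

primrec vars_below :: "fm \<Rightarrow> nat \<Rightarrow> bool" where
  "vars_below (Mem x y) n \<longleftrightarrow> x < n \<and> y < n"
| "vars_below (Eq x y) n \<longleftrightarrow> x < n \<and> y < n"
| "vars_below Bot n \<longleftrightarrow> True"
| "vars_below (Imp p q) n \<longleftrightarrow> vars_below p n \<and> vars_below q n"
| "vars_below (All p) n \<longleftrightarrow> vars_below p (Suc n)"

text \<open>Natural deduction for classical first-order logic with equality. The set of assumptions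
  may be infinite, but a derivation uses only finitely many of them.\<close>

inductive proves :: "fm set \<Rightarrow> fm \<Rightarrow> bool" (infix \<open>\<turnstile>\<close> 50) where
  assumption: "p \<in> G \<Longrightarrow> G \<turnstile> p"
| imp_intro: "insert p G \<turnstile> q \<Longrightarrow> G \<turnstile> Imp p q"
| imp_elim: "G \<turnstile> Imp p q \<Longrightarrow> G \<turnstile> p \<Longrightarrow> G \<turnstile> q"
| classical: "insert (Neg p) G \<turnstile> Bot \<Longrightarrow> G \<turnstile> p"
| all_intro: "lift ` G \<turnstile> p \<Longrightarrow> G \<turnstile> All p"
| all_elim: "G \<turnstile> All p \<Longrightarrow> G \<turnstile> inst x p"
| eq_refl: "G \<turnstile> Eq x x"
| eq_subst: "G \<turnstile> Eq x y \<Longrightarrow> G \<turnstile> inst x p \<Longrightarrow> G \<turnstile> inst y p"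


section \<open>The axioms of ZFC\<close>

definition Subset :: "nat \<Rightarrow> nat \<Rightarrow> fm" where
  "Subset x y = All (Imp (Mem 0 (x + 1)) (Mem 0 (y + 1)))"

definition Empty :: "nat \<Rightarrow> fm" where
  "Empty x = All (Neg (Mem 0 (x + 1)))"

text \<open>\<open>y = x \<union> {x}\<close>\<close>

definition Succ :: "nat \<Rightarrow> nat \<Rightarrow> fm" where
  "Succ x y = All (Iff (Mem 0 (y + 1)) (Or (Mem 0 (x + 1)) (Eq 0 (x + 1))))"

text \<open>\<open>z = {x, y}\<close>\<close>

definition Upair :: "nat \<Rightarrow> nat \<Rightarrow> nat \<Rightarrow> fm" where
  "Upair x y z = All (Iff (Mem 0 (z + 1)) (Or (Eq 0 (x + 1)) (Eq 0 (y + 1))))"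

definition Inductive :: "nat \<Rightarrow> fm" where
  "Inductive x = And (BEx x (Empty 0)) (BAll x (BEx (x + 1) (Succ 1 0)))"

definition extensionality :: fm where
  "extensionality = All (All (Imp (All (Iff (Mem 0 2) (Mem 0 1))) (Eq 1 0)))"

definition foundation :: fm where
  "foundation = All (Imp (Ex (Mem 0 1)) (BEx 0 (Neg (BEx 0 (Mem 0 2)))))"

definition pairing :: fm where
  "pairing = All (All (Ex (Upair 2 1 0)))"

definition union :: fm where
  "union = All (Ex (All (Iff (Mem 0 1) (BEx 2 (Mem 1 0)))))"

definition power_set :: fm where
  "power_set = All (Ex (All (Iff (Mem 0 1) (Subset 0 2))))"

definition infinity :: fm where
  "infinity = Ex (Inductive 0)"

text \<open>Every set of nonempty, pairwise disjoint sets has a transversal.\<close>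

definition choice :: fm where
  "choice =
     All (Imp
       (And (BAll 0 (Ex (Mem 0 1)))
            (BAll 0 (BAll 1 (Imp (Ex (And (Mem 0 1) (Mem 0 2))) (Eq 1 0)))))
       (Ex (BAll 1 (Ex (All (Iff (And (Mem 0 2) (Mem 0 3)) (Eq 0 1)))))))"

text \<open>In \<open>p\<close>, index 0 is the element variable and the indices from 1 on are parameters:
  for every \<open>A\<close> there is \<open>B = {x \<in> A. p x}\<close>.\<close>

definition separation :: "fm \<Rightarrow> fm" where
  "separation p =
     All (Ex (All (Iff (Mem 0 1)
       (And (Mem 0 2) (rename p (case_nat 0 (\<lambda>k. k + 3)))))))"

text \<open>In \<open>p\<close>, index 0 is the value, index 1 the argument, and the indices from 2 on are
  parameters: if \<open>p\<close> is single-valued on \<open>A\<close>, then there is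
  \<open>B = {y. \<exists>x\<in>A. p y x}\<close>.\<close>

definition replacement :: "fm \<Rightarrow> fm" where
  "replacement p =
     All (Imp
       (BAll 0 (All (All (Imp
          (And (rename p (case_nat 1 (case_nat 2 (\<lambda>k. k + 4))))
               (rename p (case_nat 0 (case_nat 2 (\<lambda>k. k + 4)))))
          (Eq 1 0)))))
       (Ex (All (Iff (Mem 0 1)
          (BEx 2 (rename p (case_nat 1 (case_nat 0 (\<lambda>k. k + 4)))))))))"

definition closures :: "fm \<Rightarrow> fm set" where
  "closures p = {(All ^^ n) p | n. vars_below p n}"

definition ZFC :: "fm set" where
  "ZFC = {extensionality, foundation, pairing, union, power_set, infinity, choice} \<union>
     (\<Union>p. closures (separation p)) \<union> (\<Union>p. closures (replacement p))"


section \<open>Turing machine computations in the language of set theory\<close>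

text \<open>\<open>w\<close> is the least inductive set.\<close>

definition Omega :: "nat \<Rightarrow> fm" where
  "Omega w = And (Inductive w) (All (Imp (Inductive 0) (Subset (w + 1) 0)))"

text \<open>\<open>x\<close> is the von Neumann numeral \<open>n\<close>.\<close>

primrec Num :: "nat \<Rightarrow> nat \<Rightarrow> fm" where
  "Num 0 x = Empty x"
| "Num (Suc n) x = Ex (And (Num n 0) (Succ 0 (x + 1)))"

text \<open>\<open>z = {{x}, {x, y}}\<close>\<close>

definition Pair :: "nat \<Rightarrow> nat \<Rightarrow> nat \<Rightarrow> fm" where
  "Pair x y z =
     Ex (Ex (Conj [Upair (x + 2) (x + 2) 1, Upair (x + 2) (y + 2) 0, Upair 1 0 (z + 2)]))"

text \<open>\<open>(x, y) \<in> f\<close>\<close>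

definition App :: "nat \<Rightarrow> nat \<Rightarrow> nat \<Rightarrow> fm" where
  "App f x y = Ex (And (Pair (x + 1) (y + 1) 0) (Mem 0 (f + 1)))"

text \<open>\<open>f\<close> is a function with domain \<open>A\<close>.\<close>

definition Function :: "nat \<Rightarrow> nat \<Rightarrow> fm" where
  "Function f A = Conj
     [BAll f (Ex (Ex (Pair 1 0 2))),
      All (Iff (Mem 0 (A + 1)) (Ex (App (f + 2) 1 0))),
      All (All (All (Imp (And (App (f + 3) 2 1) (App (f + 3) 2 0)) (Eq 1 0))))]"

text \<open>\<open>f\<close> is a function from \<open>A\<close> to \<open>B\<close>.\<close>

definition Maps :: "nat \<Rightarrow> nat \<Rightarrow> nat \<Rightarrow> fm" where
  "Maps f A B =
     And (Function f A) (All (All (Imp (App (f + 2) 1 0) (Mem 0 (B + 2)))))"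

text \<open>\<open>f(x) = k\<close> and \<open>f(i) = k\<close> for numerals \<open>i\<close> and \<open>k\<close>.\<close>

definition App_Num :: "nat \<Rightarrow> nat \<Rightarrow> nat \<Rightarrow> fm" where
  "App_Num f x k = Ex (And (Num k 0) (App (f + 1) (x + 1) 0))"

definition App_Num_Num :: "nat \<Rightarrow> nat \<Rightarrow> nat \<Rightarrow> fm" where
  "App_Num_Num f i k = Ex (And (Num i 0) (App_Num (f + 1) 0 k))"

text \<open>In the following, \<open>w\<close> is the variable denoting the set of natural numbers. Binary
  strings are functions from a natural number to \<open>2\<close>, and tapes are functions from the
  natural numbers to \<open>4\<close>.\<close>

fun sym_code :: "sym \<Rightarrow> nat" where
  "sym_code Zero = 0"
| "sym_code One = 1"
| "sym_code Blank = 2"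
| "sym_code Mark = 3"

definition Binary_String :: "nat \<Rightarrow> nat \<Rightarrow> fm" where
  "Binary_String w s = BEx w (Ex (And (Num 2 0) (Maps (s + 2) 1 0)))"

definition Tape :: "nat \<Rightarrow> nat \<Rightarrow> fm" where
  "Tape w t = Ex (And (Num 4 0) (Maps (t + 1) (w + 1) 0))"

text \<open>\<open>t(0)\<close> is the marker, and for \<open>i \<in> w\<close> and \<open>j = i + 1\<close>,
  \<open>t(j) = s(i)\<close> if \<open>s(i)\<close> is defined and \<open>t(j)\<close> is blank otherwise.\<close>

definition Initial_Tape :: "nat \<Rightarrow> nat \<Rightarrow> nat \<Rightarrow> fm" where
  "Initial_Tape w s t = Conj
     [Tape w t,
      App_Num_Num t 0 (sym_code Mark),
      BAll w (Ex (Conj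
        [Succ 1 0,
         All (Imp (App (s + 3) 2 0) (App (t + 3) 1 0)),
         Imp (Neg (Ex (App (s + 3) 2 0))) (App_Num (t + 2) 0 (sym_code Blank))]))]"

text \<open>\<open>c = (q, (h, t))\<close>\<close>

definition Config :: "nat \<Rightarrow> nat \<Rightarrow> nat \<Rightarrow> nat \<Rightarrow> fm" where
  "Config q h t c = Ex (And (Pair (h + 1) (t + 1) 0) (Pair (q + 1) 0 (c + 1)))"

text \<open>States are coded by their positions in an enumeration \<open>qs\<close> of the state set.\<close>

definition state_code :: "'q list \<Rightarrow> 'q \<Rightarrow> nat" where
  "state_code qs q = (LEAST i. i < length qs \<and> qs ! i = q)"

fun Move :: "dir \<Rightarrow> nat \<Rightarrow> nat \<Rightarrow> fm" where
  "Move MoveL h h' = Or (Succ h' h) (And (Empty h) (Empty h'))"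
| "Move MoveS h h' = Eq h' h"
| "Move MoveR h h' = Succ h h'"

text \<open>The six existentially quantified variables are \<open>q, h, t, q', h', t'\<close>, with indices
  5 down to 0, such that \<open>c = (q, (h, t))\<close> and \<open>d = (q', (h', t'))\<close>.\<close>

definition Step :: "'q list \<Rightarrow> 'q tm \<Rightarrow> nat \<Rightarrow> nat \<Rightarrow> nat \<Rightarrow> fm" where
  "Step qs M w c d = Ex (Ex (Ex (Ex (Ex (Ex (Conj
     [Config 5 4 3 (c + 6),
      Config 2 1 0 (d + 6),
      Tape (w + 6) 0,
      BAll (w + 6) (Imp (Neg (Eq 0 5)) (All (Imp (App 5 1 0) (App 2 1 0)))),
      Disj [case delta M q a of (q', b, m) \<Rightarrow> Conj
              [Num (state_code qs q) 5,
               App_Num 3 4 (sym_code a),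
               Num (state_code qs q') 2,
               App_Num 0 4 (sym_code b),
               Move m 4 1].
            q \<leftarrow> qs, a \<leftarrow> [Zero, One, Blank, Mark]]]))))))"

definition Initial_Config :: "'q list \<Rightarrow> 'q tm \<Rightarrow> nat \<Rightarrow> nat \<Rightarrow> nat \<Rightarrow> fm" where
  "Initial_Config qs M w s c = Ex (Ex (Ex (Conj
     [Num (state_code qs (start M)) 2,
      Empty 1,
      Initial_Tape (w + 3) (s + 3) 0,
      Config 2 1 0 (c + 3)])))"

text \<open>\<open>c\<close> is halting and the longest binary word starting in cell 1 is the word 1.\<close>

definition Halted_With_1 :: "'q list \<Rightarrow> 'q tm \<Rightarrow> nat \<Rightarrow> fm" where
  "Halted_With_1 qs M c = Ex (Ex (Ex (Conj
     [Config 2 1 0 (c + 3),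
      Num (state_code qs (halt M)) 2,
      App_Num_Num 0 1 (sym_code One),
      Neg (App_Num_Num 0 2 (sym_code Zero)),
      Neg (App_Num_Num 0 2 (sym_code One))])))"

text \<open>There are \<open>n \<in> w\<close> (index 2), \<open>m = n + 1\<close> (index 1) and a function \<open>f\<close> on
  \<open>m\<close> (index 0) such that \<open>f(0)\<close> is the initial configuration for \<open>s\<close>, every
  \<open>f(i)\<close> with \<open>i < n\<close> steps to \<open>f(i + 1)\<close>, and \<open>f(n)\<close> is halting with output 1.\<close>

definition Outputs_1 :: "'q list \<Rightarrow> 'q tm \<Rightarrow> nat \<Rightarrow> nat \<Rightarrow> fm" where
  "Outputs_1 qs M w s = BEx w (Ex (Ex (Conj
     [Succ 2 1,
      Function 0 1,
      Ex (Ex (Conj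
        [Empty 1, App 2 1 0, Initial_Config qs M (w + 5) (s + 5) 0])),
      BAll 2 (Ex (Ex (Ex (Conj
        [Succ 3 2, App 4 3 1, App 4 2 0, Step qs M (w + 7) 1 0])))),
      Ex (And (App 1 3 0) (Halted_With_1 qs M 0))])))"

text \<open>The sentence stating that \<open>M\<close> outputs 1 on every binary string.\<close>

definition all_outputs_1 :: "'q list \<Rightarrow> 'q tm \<Rightarrow> fm" where
  "all_outputs_1 qs M =
     Ex (And (Omega 0) (All (Imp (Binary_String 1 0) (Outputs_1 qs M 1 0))))"

end

theory Submission
  imports Defs "HOL-Library.Countable" "HOL-Library.Infinite_Set"
begin

text \<open>After \<open>n\<close> steps the head is at most in cell \<open>n\<close>. On the prefix of length \<open>K\<close> of an input the
  machine stops after fewer than \<open>K\<close> steps, so on the whole input it makes the same moves.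

  Provability is obtained from the completeness theorem: it suffices to check the sentence in every
  model of ZFC. There a binary string \<open>s\<close> either has a standard length below \<open>K\<close>, or all the
  numerals below \<open>K\<close> lie in its domain. In both cases an actual string \<open>r\<close> of length at most \<open>K\<close>
  agrees with \<open>s\<close> on all cells that the machine visits. The halting run on \<open>r\<close> has finitely many
  steps, and it is copied into the model: each tape is obtained by replacement from the previous
  one, and the run, being a finite set of pairs, by pairing and union.\<close>

section \<open>Completeness of the calculus\<close>

lemma proves_mono: "G \<turnstile> p \<Longrightarrow> G \<subseteq> H \<Longrightarrow> H \<turnstile> p"
proof (induction arbitrary: H rule: proves.induct)
  case (assumption p G)
  then show ?case by (auto intro: proves.assumption)
next
  case (imp_intro p G q)
  then show ?case by (metis insert_mono proves.imp_intro)
next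
  case (imp_elim G p q)
  then show ?case by (metis proves.imp_elim)
next
  case (classical p G)
  then show ?case by (metis insert_mono proves.classical)
next
  case (all_intro G p)
  then show ?case by (metis image_mono proves.all_intro)
next
  case (all_elim G p x)
  then show ?case by (metis proves.all_elim)
next
  case (eq_refl G x)
  show ?case by (rule proves.eq_refl)
next
  case (eq_subst G x y p)
  show ?case
    by (rule proves.eq_subst[OF eq_subst.IH(1,2)]) (rule eq_subst.prems)+
qed

lemma proves_finite: "G \<turnstile> p \<Longrightarrow> \<exists>F. finite F \<and> F \<subseteq> G \<and> F \<turnstile> p"
proof (induction rule: proves.induct)
  case (assumption p G)
  then show ?case by (intro exI[of _ "{p}"]) (auto intro: proves.assumption)
next
  case (imp_intro p G q)
  then obtain F where "finite F" "F \<subseteq> insert p G" "F \<turnstile> q" by blast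
  then show ?case
    by (intro exI[of _ "F - {p}"]) (auto intro!: proves.imp_intro elim: proves_mono)
next
  case (imp_elim G p q)
  then obtain F F' where "finite F" "F \<subseteq> G" "F \<turnstile> Imp p q" "finite F'" "F' \<subseteq> G" "F' \<turnstile> p"
    by blast
  then show ?case
    by (intro exI[of _ "F \<union> F'"]) (auto intro: proves.imp_elim[of _ p] elim: proves_mono)
next
  case (classical p G)
  then obtain F where "finite F" "F \<subseteq> insert (Neg p) G" "F \<turnstile> Bot" by blast
  then show ?case
    by (intro exI[of _ "F - {Neg p}"]) (auto intro!: proves.classical[of p] elim: proves_mono)
next
  case (all_intro G p)
  then obtain F where "finite F" "F \<subseteq> lift ` G" "F \<turnstile> p" by blast
  \<comment> \<open>The finitely many assumptions used lie in the image of \<open>lift\<close>, so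
    they are pulled back to finitely many members of \<open>G\<close>.\<close>
  then obtain F' where "finite F'" "F' \<subseteq> G" "F = lift ` F'"
    by (meson finite_subset_image)
  then show ?case using \<open>F \<turnstile> p\<close> by (auto intro: proves.all_intro)
next
  case (all_elim G p x)
  then show ?case by (blast intro: proves.all_elim)
next
  case (eq_refl G x)
  then show ?case by (blast intro: proves.eq_refl)
next
  case (eq_subst G x y p)
  then obtain F F' where "finite F" "F \<subseteq> G" "F \<turnstile> Eq x y" "finite F'" "F' \<subseteq> G" "F' \<turnstile> inst x p"
    by blast
  then show ?case
    by (intro exI[of _ "F \<union> F'"])
      (auto intro!: proves.eq_subst[of "F \<union> F'" x y p] elim: proves_mono)
qed

section \<open>Renaming of variables and generalization over a fresh variable\<close>

lemma rename_rename: "rename (rename p r) r' = rename p (\<lambda>k. r' (r k))"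
proof (induction p arbitrary: r r')
  case (All p)
  have "(\<lambda>k. case_nat 0 (\<lambda>k. Suc (r' k)) (case_nat 0 (\<lambda>k. Suc (r k)) k))
      = case_nat 0 (\<lambda>k. Suc (r' (r k)))"
    by (auto split: nat.split)
  then show ?case by (simp add: All)
qed auto

lemma rename_cong:
  "vars_below p n \<Longrightarrow> (\<And>k. k < n \<Longrightarrow> r k = r' k) \<Longrightarrow> rename p r = rename p r'"
proof (induction p arbitrary: n r r')
  case (All p)
  have "rename p (case_nat 0 (\<lambda>k. Suc (r k))) = rename p (case_nat 0 (\<lambda>k. Suc (r' k)))"
    using All.prems by (intro All.IH[of "Suc n"]) (auto split: nat.split)
  then show ?case by simp
next
  case (Imp p q)
  have "rename p r = rename p r'" "rename q r = rename q r'"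
    using Imp.prems by (auto intro: Imp.IH[of n])
  then show ?case by simp
qed auto

lemma rename_id: "rename p (\<lambda>k. k) = p"
proof (induction p)
  case (All p)
  have "case_nat 0 (\<lambda>k. Suc k) = (\<lambda>k. k)" by (auto split: nat.split)
  then show ?case by (simp add: All)
qed auto

lemma vars_below_mono: "vars_below p n \<Longrightarrow> n \<le> m \<Longrightarrow> vars_below p m"
  by (induction p arbitrary: n m) auto

lemma ex_vars_below: "\<exists>n. vars_below p n"
proof (induction p)
  case (Mem x y)
  then show ?case by (intro exI[of _ "Suc (max x y)"]) auto
next
  case (Eq x y)
  then show ?case by (intro exI[of _ "Suc (max x y)"]) auto
next
  case (Imp p q)
  then obtain n m where "vars_below p n" "vars_below q m" by blast
  then show ?case by (intro exI[of _ "max n m"]) (auto elim: vars_below_mono)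
next
  case (All p)
  then obtain n where "vars_below p n" by blast
  then show ?case by (intro exI[of _ n]) (auto elim: vars_below_mono)
qed auto

lemma rename_lift: "rename (lift p) (case_nat 0 (\<lambda>k. Suc (r k))) = lift (rename p r)"
  by (simp add: lift_def rename_rename)

lemma rename_inst: "rename (inst x p) r = inst (r x) (rename p (case_nat 0 (\<lambda>k. Suc (r k))))"
proof -
  have "(\<lambda>k. r (case_nat x (\<lambda>k. k) k)) =
        (\<lambda>k. case_nat (r x) (\<lambda>k. k) (case_nat 0 (\<lambda>k. Suc (r k)) k))"
    by (auto split: nat.split)
  then show ?thesis by (simp add: inst_def rename_rename)
qed

text \<open>Each rule is stable under renaming. The renaming stays arbitrary in the induction
  because it is shifted under a quantifier. The purpose is to exchange a fresh variable for the one
  bound by \<open>all_intro\<close>.\<close>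

lemma proves_rename: "G \<turnstile> p \<Longrightarrow> (\<lambda>q. rename q r) ` G \<turnstile> rename p r"
proof (induction arbitrary: r rule: proves.induct)
  case (classical p G)
  then show ?case by (auto intro!: proves.classical[of "rename p r"] simp: Neg_def)
next
  case (all_intro G p)
  have "lift ` (\<lambda>q. rename q r) ` G = (\<lambda>q. rename q (case_nat 0 (\<lambda>k. Suc (r k)))) ` lift ` G"
    by (simp add: image_image rename_lift)
  then show ?case using all_intro.IH by (auto intro!: proves.all_intro)
next
  case (all_elim G p x)
  then show ?case unfolding rename_inst by (auto intro!: proves.all_elim)
next
  case (eq_subst G x y p)
  then show ?case unfolding rename_inst
    by (metis proves.eq_subst rename.simps(2))
next
  case (imp_elim G p q)
  then show ?case by (metis proves.imp_elim rename.simps(4))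
qed (auto intro: proves.assumption proves.imp_intro proves.eq_refl)

text \<open>\<open>all_intro\<close> has index 0 as its eigenvariable and shifts the assumptions.
  Here the free variable \<open>n\<close> is the eigenvariable, and a renaming turns the given
  derivation into the premise of that rule.\<close>

lemma all_intro_fresh:
  assumes G: "\<And>g. g \<in> G \<Longrightarrow> vars_below g n" and p: "vars_below p (Suc n)"
    and "G \<turnstile> inst n p"
  shows "G \<turnstile> All p"
proof (rule proves.all_intro)
  \<comment> \<open>Below \<open>n\<close> this is the shift \<open>Suc\<close>, so it acts as
    \<open>lift\<close> on \<open>G\<close>; sending \<open>n\<close> to 0 undoes the instantiation
    of \<open>p\<close>.\<close>
  define r where "r k = (if k = n then 0 else Suc k)" for k
  have "(\<lambda>q. rename q r) ` G = lift ` G"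
    unfolding lift_def using G by (intro image_cong refl rename_cong) (auto simp: r_def)
  moreover have "rename (inst n p) r = rename p (\<lambda>k. k)"
    unfolding inst_def rename_rename using p
    by (rule rename_cong) (auto simp: r_def split: nat.split)
  ultimately show "lift ` G \<turnstile> p"
    using proves_rename[OF assms(3), of r] by (simp add: rename_id)
qed

section \<open>Consistent sets and their Henkin extensions\<close>

definition consistent :: "fm set \<Rightarrow> bool" where
  "consistent G \<longleftrightarrow> \<not> G \<turnstile> Bot"

lemma proves_cut: "G \<turnstile> p \<Longrightarrow> insert p G \<turnstile> q \<Longrightarrow> G \<turnstile> q"
  by (rule proves.imp_elim[OF proves.imp_intro])

lemma consistent_extend:
  assumes "consistent G" shows "consistent (insert p G) \<or> consistent (insert (Neg p) G)"
  using assms proves.classical[of p G] proves_cut[of G p Bot] unfolding consistent_def by blast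

text \<open>An inconsistency would give a derivation of \<open>inst n p\<close> from
  \<open>G\<close>. As \<open>n\<close> is fresh for \<open>G\<close>, it generalizes to
  \<open>All p\<close>, against \<open>Neg (All p)\<close>.\<close>

lemma consistent_witness:
  assumes "consistent G" "Neg (All p) \<in> G" "\<And>g. g \<in> G \<Longrightarrow> vars_below g n"
  shows "consistent (insert (Neg (inst n p)) G)"
proof (rule ccontr)
  assume "\<not> ?thesis"
  then have "G \<turnstile> inst n p" by (simp add: consistent_def proves.classical)
  moreover have "vars_below p (Suc n)"
    using assms(3)[OF assms(2)] by (simp add: Neg_def)
  ultimately have "G \<turnstile> All p" using assms(3) by (intro all_intro_fresh)
  moreover have "G \<turnstile> Neg (All p)" by (simp add: assms proves.assumption)
  ultimately show False using assms(1) unfolding consistent_def Neg_def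
    by (blast intro: proves.imp_elim)
qed

instance fm :: countable by countable_datatype

text \<open>Formulas are enumerated and decided one by one, as in Lindenbaum's lemma. Free variables
  serve as Henkin constants: a rejected universal formula receives a counterexample variable at the
  same stage.\<close>

lemma henkin_extension:
  assumes con: "consistent G" and bd: "\<And>g. g \<in> G \<Longrightarrow> vars_below g n"
  obtains H where "G \<subseteq> H" "consistent H" "\<And>p. p \<in> H \<or> Neg p \<in> H"
    "\<And>p. All p \<in> H \<or> (\<exists>x. Neg (inst x p) \<in> H)"
proof -
  \<comment> \<open>The bound on the variables is kept at every stage, so that a fresh variable is
    always available. The union of all stages may lose it.\<close>
  define ok where "ok F \<longleftrightarrow> consistent F \<and> (\<exists>n. \<forall>g\<in>F. vars_below g n)" for F
  define nxt where "nxt p F F' \<longleftrightarrow> F \<subseteq> F' \<and> (p \<in> F' \<or> Neg p \<in> F') \<and>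
     (\<forall>q. p = All q \<longrightarrow> p \<in> F' \<or> (\<exists>x. Neg (inst x q) \<in> F'))" for p F F'
  have ok_insert: "ok (insert p F)" if ok: "ok F" and c: "consistent (insert p F)" for p F
  proof -
    obtain m k where "\<forall>g\<in>F. vars_below g m" "vars_below p k"
      using ok ex_vars_below unfolding ok_def by blast
    then have "\<forall>g\<in>insert p F. vars_below g (max m k)"
      by (auto intro: vars_below_mono[of _ m] vars_below_mono[of _ k])
    with c show ?thesis unfolding ok_def by blast
  qed
  have step: "\<exists>F'. ok F' \<and> nxt p F F'" if ok: "ok F" for p F
  proof (cases "consistent (insert p F)")
    case True
    then show ?thesis using ok_insert[OF ok True] by (intro exI[of _ "insert p F"]) (auto simp: nxt_def)
  next
    case False
    then have c: "consistent (insert (Neg p) F)"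
      using ok consistent_extend unfolding ok_def by blast
    note ok' = ok_insert[OF ok c]
    show ?thesis
    proof (cases "\<exists>q. p = All q")
      case True
      then obtain q where q: "p = All q" by blast
      obtain m where "\<forall>g\<in>insert (Neg p) F. vars_below g m" using ok' unfolding ok_def by blast
      then have "consistent (insert (Neg (inst m q)) (insert (Neg p) F))"
        using c q by (intro consistent_witness) auto
      from ok_insert[OF ok' this] show ?thesis
        by (intro exI[of _ "insert (Neg (inst m q)) (insert (Neg p) F)"]) (auto simp: nxt_def q)
    next
      case False
      then show ?thesis using ok' by (intro exI[of _ "insert (Neg p) F"]) (auto simp: nxt_def)
    qed
  qed
  have "ok G" using con bd unfolding ok_def by blast
  \<comment> \<open>Dependent choice along the enumeration of formulas; the clause for
    \<open>k = 0\<close> fixes the first stage.\<close>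
  then obtain S where S: "S 0 = G" "\<And>k. ok (S k)" "\<And>k. nxt (from_nat k) (S k) (S (Suc k))"
    using dependent_nat_choice[of "\<lambda>k F. ok F \<and> (k = 0 \<longrightarrow> F = G)" "\<lambda>k. nxt (from_nat k)"] step
    by (metis (no_types, lifting) nat.distinct(1))
  define H where "H = (\<Union>k. S k)"
  have mono: "S i \<subseteq> S j" if "i \<le> j" for i j
    using that by (rule lift_Suc_mono_le[of S, rotated]) (use S(3) in \<open>simp add: nxt_def\<close>)
  have S_H: "S k \<subseteq> H" for k by (auto simp: H_def)
  show thesis
  proof
    show "G \<subseteq> H" using S(1) S_H by blast
    show "consistent H"
      unfolding consistent_def
    proof
      assume "H \<turnstile> Bot"
      then obtain F where F: "finite F" "F \<subseteq> H" "F \<turnstile> Bot" using proves_finite by blast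
      \<comment> \<open>The stages form a chain, so the finitely many assumptions of a derivation
        already lie in one of them.\<close>
      have "\<exists>k. F \<subseteq> S k" using F(1,2)
      proof induction
        case (insert x F)
        then obtain k j where "F \<subseteq> S k" "x \<in> S j" by (auto simp: H_def)
        then have "insert x F \<subseteq> S (max k j)" using mono[of k "max k j"] mono[of j "max k j"] by auto
        then show ?case ..
      qed auto
      then show False using F(3) S(2) unfolding ok_def consistent_def by (meson proves_mono)
    qed
  next
    fix p :: fm
    have "p = from_nat (to_nat p)" by simp
    then show "p \<in> H \<or> Neg p \<in> H" using S(3)[of "to_nat p"] S_H unfolding nxt_def by auto
  next
    fix p :: fm
    have "All p = from_nat (to_nat (All p))" by simp
    then show "All p \<in> H \<or> (\<exists>x. Neg (inst x p) \<in> H)"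
      using S(3)[of "to_nat (All p)"] S_H[of "Suc (to_nat (All p))"]
      unfolding nxt_def by (metis subsetD)
  qed
qed

section \<open>Satisfaction and the model built from variables\<close>

primrec sat :: "'a set \<Rightarrow> ('a \<Rightarrow> 'a \<Rightarrow> bool) \<Rightarrow> (nat \<Rightarrow> 'a) \<Rightarrow> fm \<Rightarrow> bool" where
  "sat D E e (Mem x y) \<longleftrightarrow> E (e x) (e y)"
| "sat D E e (Eq x y) \<longleftrightarrow> e x = e y"
| "sat D E e Bot \<longleftrightarrow> False"
| "sat D E e (Imp p q) \<longleftrightarrow> (sat D E e p \<longrightarrow> sat D E e q)"
| "sat D E e (All p) \<longleftrightarrow> (\<forall>a\<in>D. sat D E (case_nat a e) p)"

lemma sat_rename: "sat D E e (rename p r) \<longleftrightarrow> sat D E (\<lambda>k. e (r k)) p"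
proof (induction p arbitrary: e r)
  case (All p)
  have "(\<lambda>k. case_nat a e (case_nat 0 (\<lambda>k. Suc (r k)) k)) = case_nat a (\<lambda>k. e (r k))" for a
    by (auto split: nat.split)
  then show ?case by (simp add: All)
qed auto

text \<open>The elements are variables modulo the equations in the Henkin set \<open>H\<close>, each
  class being represented by its least member. Membership in \<open>H\<close> then coincides with
  truth.\<close>

theorem model_existence:
  assumes con: "consistent G" and bd: "\<And>g. g \<in> G \<Longrightarrow> vars_below g n"
  obtains D :: "nat set" and E e where "range e \<subseteq> D" "\<And>g. g \<in> G \<Longrightarrow> sat D E e g"
proof -
  obtain H where H: "G \<subseteq> H" "consistent H" "\<And>p. p \<in> H \<or> Neg p \<in> H"
    "\<And>p. All p \<in> H \<or> (\<exists>x. Neg (inst x p) \<in> H)"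
    using henkin_extension[OF con bd] by blast
  have closed: "p \<in> H" if "H \<turnstile> p" for p
    using H(2,3) that unfolding consistent_def Neg_def by (meson proves.imp_elim proves.assumption)
  have Neg_iff: "Neg p \<in> H \<longleftrightarrow> p \<notin> H" for p
    using H(2,3) unfolding consistent_def Neg_def by (meson proves.imp_elim proves.assumption)
  have Imp_iff: "Imp p q \<in> H \<longleftrightarrow> (p \<in> H \<longrightarrow> q \<in> H)" for p q
  proof
    assume "Imp p q \<in> H"
    then show "p \<in> H \<longrightarrow> q \<in> H" using closed by (meson proves.imp_elim proves.assumption)
  next
    assume pq: "p \<in> H \<longrightarrow> q \<in> H"
    show "Imp p q \<in> H"
    proof (rule closed, rule proves.imp_intro)
      show "insert p H \<turnstile> q"
      proof (cases "p \<in> H")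
        case True
        then show ?thesis using pq by (simp add: proves.assumption)
      next
        case False
        then have "insert (Neg q) (insert p H) \<turnstile> Imp p Bot" "insert (Neg q) (insert p H) \<turnstile> p"
          using Neg_iff by (auto intro: proves.assumption simp: Neg_def)
        then show ?thesis by (blast intro: proves.classical proves.imp_elim)
      qed
    qed
  qed
  have All_iff: "All p \<in> H \<longleftrightarrow> (\<forall>x. inst x p \<in> H)" for p
    using H(4)[of p] Neg_iff closed by (meson proves.all_elim proves.assumption)
  have refl: "Eq x x \<in> H" for x by (simp add: closed proves.eq_refl)
  have subst: "inst x p \<in> H \<Longrightarrow> inst y p \<in> H" if "Eq x y \<in> H" for x y p
    using that closed by (meson proves.eq_subst proves.assumption)
  \<comment> \<open>Symmetry, transitivity and congruence are instances of Leibniz substitution: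
    index 0 marks the replaced place, and the other variable of the pattern is shifted by
    \<open>Suc\<close>.\<close>
  have sym: "Eq y x \<in> H" if "Eq x y \<in> H" for x y
    using subst[OF that, of "Eq 0 (Suc x)"] refl[of x] by (simp add: inst_def)
  have trans: "Eq x z \<in> H" if "Eq x y \<in> H" "Eq y z \<in> H" for x y z
    using subst[OF that(2), of "Eq (Suc x) 0"] that(1) by (simp add: inst_def)
  have Mem1: "Mem y z \<in> H" if "Eq x y \<in> H" "Mem x z \<in> H" for x y z
    using subst[OF that(1), of "Mem 0 (Suc z)"] that(2) by (simp add: inst_def)
  have Mem2: "Mem z y \<in> H" if "Eq x y \<in> H" "Mem z x \<in> H" for x y z
    using subst[OF that(1), of "Mem (Suc z) 0"] that(2) by (simp add: inst_def)
  define c where "c x = (LEAST y. Eq x y \<in> H)" for x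
  have c: "Eq x (c x) \<in> H" for x
    unfolding c_def using refl by (rule LeastI)
  have c_eq: "c x = c y \<longleftrightarrow> Eq x y \<in> H" for x y
  proof
    assume "c x = c y"
    then show "Eq x y \<in> H" using c[of x] c[of y] sym trans by metis
  next
    assume "Eq x y \<in> H"
    then have "Eq x z \<in> H \<longleftrightarrow> Eq y z \<in> H" for z using sym trans by metis
    then show "c x = c y" by (simp add: c_def)
  qed
  define E where "E x y \<longleftrightarrow> Mem x y \<in> H" for x y
  have E: "E (c x) (c y) \<longleftrightarrow> Mem x y \<in> H" for x y
    unfolding E_def using c[of x] c[of y] sym Mem1 Mem2 by metis
  \<comment> \<open>The renaming \<open>r\<close> is general so that the quantifier case can use
    \<open>case_nat x r\<close>, which evaluates the bound variable at the class of
    \<open>x\<close>.\<close>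
  have sat: "sat (range c) E (\<lambda>k. c (r k)) p \<longleftrightarrow> rename p r \<in> H" for p r
  proof (induction p arbitrary: r)
    case Bot
    then show ?case using H(2) by (auto simp: consistent_def intro: proves.assumption)
  next
    case (All p)
    have 1: "case_nat (c x) (\<lambda>k. c (r k)) = (\<lambda>k. c (case_nat x r k))" for x
      by (auto split: nat.split)
    have 2: "inst x (rename p (case_nat 0 (\<lambda>k. Suc (r k)))) = rename p (case_nat x r)" for x
    proof -
      have "(\<lambda>k. case_nat x (\<lambda>k. k) (case_nat 0 (\<lambda>k. Suc (r k)) k)) = case_nat x r"
        by (auto split: nat.split)
      then show ?thesis by (simp add: inst_def rename_rename)
    qed
    show ?case by (simp add: All_iff 1 2 All)
  qed (auto simp: E c_eq Imp_iff)
  show thesis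
  proof
    show "range (\<lambda>k. c k) \<subseteq> range c" by simp
    show "sat (range c) E (\<lambda>k. c k) g" if "g \<in> G" for g
      using sat[of "\<lambda>k. k" g] that H(1) by (auto simp: rename_id)
  qed
qed

lemma sat_connectives [simp]:
  "sat D E e (Neg p) \<longleftrightarrow> \<not> sat D E e p"
  "sat D E e (And p q) \<longleftrightarrow> sat D E e p \<and> sat D E e q"
  "sat D E e (Or p q) \<longleftrightarrow> sat D E e p \<or> sat D E e q"
  "sat D E e (Iff p q) \<longleftrightarrow> (sat D E e p \<longleftrightarrow> sat D E e q)"
  "sat D E e (Ex p) \<longleftrightarrow> (\<exists>a\<in>D. sat D E (case_nat a e) p)"
  "sat D E e (BAll x p) \<longleftrightarrow> (\<forall>a\<in>D. E a (e x) \<longrightarrow> sat D E (case_nat a e) p)"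
  "sat D E e (BEx x p) \<longleftrightarrow> (\<exists>a\<in>D. E a (e x) \<and> sat D E (case_nat a e) p)"
  by (auto simp: Neg_def And_def Or_def Iff_def Ex_def BAll_def BEx_def)

lemma sat_Conj [simp]: "sat D E e (Conj ps) \<longleftrightarrow> (\<forall>p\<in>set ps. sat D E e p)"
  by (induction ps) (auto simp: Conj_def)

lemma sat_Disj [simp]: "sat D E e (Disj ps) \<longleftrightarrow> (\<exists>p\<in>set ps. sat D E e p)"
  by (induction ps) (auto simp: Disj_def)

lemma sat_cong: "vars_below p n \<Longrightarrow> (\<And>k. k < n \<Longrightarrow> e k = e' k) \<Longrightarrow> sat D E e p \<longleftrightarrow> sat D E e' p"
proof (induction p arbitrary: n e e')
  case (Imp p q)
  have "sat D E e p = sat D E e' p" "sat D E e q = sat D E e' q"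
    using Imp.prems by (auto intro!: Imp.IH[of n])
  then show ?case by simp
next
  case (All p)
  have "sat D E (case_nat a e) p \<longleftrightarrow> sat D E (case_nat a e') p" for a
    using All.prems by (intro All.IH[of "Suc n"]) (auto split: nat.split)
  then show ?case by simp
qed auto

section \<open>Transfer of models of ZFC to the type of natural numbers\<close>

lemma vars_below_All_power: "vars_below ((All ^^ n) p) m \<longleftrightarrow> vars_below p (m + n)"
  by (induction n arbitrary: m) auto

lemma vars_below_ZFC: "p \<in> ZFC \<Longrightarrow> vars_below p 0"
  by (auto simp: ZFC_def closures_def vars_below_All_power extensionality_def foundation_def
      pairing_def union_def power_set_def infinity_def choice_def Iff_def And_def Neg_def Or_def
      Ex_def BEx_def BAll_def Upair_def Subset_def Inductive_def Empty_def Succ_def)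

text \<open>Truth is invariant under isomorphism; this replaces a domain \<open>D\<close> by a whole
  type.\<close>

lemma sat_bij_betw:
  assumes "bij_betw g UNIV D"
  shows "sat UNIV (\<lambda>x y. E (g x) (g y)) e p \<longleftrightarrow> sat D E (\<lambda>k. g (e k)) p"
proof (induction p arbitrary: e)
  case (Eq x y)
  then show ?case using assms by (auto simp: bij_betw_def inj_on_def)
next
  case (All p)
  have "(\<lambda>k. g (case_nat a e k)) = case_nat (g a) (\<lambda>k. g (e k))" for a
    by (auto split: nat.split)
  moreover have "D = range g" using assms by (simp add: bij_betw_def)
  ultimately show ?case by (simp add: All)
qed auto

text \<open>In a finite model some \<open>a\<close> has the most members. Foundation excludes
  \<open>a\<close> from itself, so the union of \<open>a\<close> and its singleton has one member
  more.\<close>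

lemma ZFC_model_infinite:
  assumes sat: "\<And>p. p \<in> ZFC \<Longrightarrow> sat D E e p" and "D \<noteq> {}"
  shows "infinite D"
proof
  assume fin: "finite D"
  define m where "m a = card {x \<in> D. E x a}" for a
  obtain a where a: "a \<in> D" "\<And>b. b \<in> D \<Longrightarrow> m b \<le> m a"
    using obtains_MAX[OF fin \<open>D \<noteq> {}\<close>, of m] fin by (metis Max_ge finite_imageI image_eqI)
  have pair: "\<exists>c\<in>D. \<forall>x\<in>D. E x c \<longleftrightarrow> x = a \<or> x = b" if "a \<in> D" "b \<in> D" for a b
    using sat[of pairing] that by (simp add: ZFC_def pairing_def Upair_def)
  \<comment> \<open>Here \<open>s\<close> is the singleton of \<open>a\<close>, \<open>c\<close> is
    the pair of \<open>a\<close> and \<open>s\<close>, and their union \<open>u\<close> is the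
    successor of \<open>a\<close>.\<close>
  obtain s where s: "s \<in> D" "\<forall>x\<in>D. E x s \<longleftrightarrow> x = a"
    using pair[OF a(1) a(1)] by auto
  obtain c where c: "c \<in> D" "\<forall>x\<in>D. E x c \<longleftrightarrow> x = a \<or> x = s"
    using pair[OF a(1) s(1)] by auto
  obtain u where u: "u \<in> D" "\<forall>x\<in>D. E x u \<longleftrightarrow> (\<exists>b\<in>D. E b c \<and> E x b)"
    using sat[of union] c(1) by (auto simp: ZFC_def union_def)
  have "\<forall>s\<in>D. (\<exists>x\<in>D. E x s) \<longrightarrow> (\<exists>x\<in>D. E x s \<and> \<not> (\<exists>y\<in>D. E y x \<and> E y s))"
    using sat[of foundation] by (simp add: ZFC_def foundation_def)
  then have "\<exists>x\<in>D. E x s \<and> \<not> (\<exists>y\<in>D. E y x \<and> E y s)" using a(1) s by blast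
  then have "\<not> E a a" using a s by auto
  moreover have "{x \<in> D. E x u} = insert a {x \<in> D. E x a}"
    using u c s a by auto
  ultimately have "m u = Suc (m a)" using fin by (simp add: m_def)
  then show False using a(2)[OF u(1)] by simp
qed

text \<open>If \<open>q\<close> were not provable, its negation would hold in a model of ZFC on a
  set of naturals. That set is infinite, so its enumeration carries the model to all of
  \<open>nat\<close>, which lets the hypothesis speak of a single type.\<close>

theorem ZFC_completeness:
  assumes "\<And>(E :: nat \<Rightarrow> nat \<Rightarrow> bool) e. (\<And>p e'. p \<in> ZFC \<Longrightarrow> sat UNIV E e' p) \<Longrightarrow> sat UNIV E e q"
  shows "ZFC \<turnstile> q"
proof (rule ccontr)
  assume "\<not> ZFC \<turnstile> q"
  then have con: "consistent (insert (Neg q) ZFC)"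
    unfolding consistent_def using proves.classical by blast
  obtain n where "vars_below (Neg q) n" using ex_vars_below by blast
  then have bd: "vars_below g n" if "g \<in> insert (Neg q) ZFC" for g
    using that vars_below_ZFC vars_below_mono[of g 0 n] by blast
  obtain D :: "nat set" and E e where D: "range e \<subseteq> D" and
    sat: "\<And>g. g \<in> insert (Neg q) ZFC \<Longrightarrow> sat D E e g"
    by (rule model_existence[OF con bd]; blast)
  have "infinite D" using sat D by (intro ZFC_model_infinite[of D E e]) auto
  then have bij: "bij_betw (enumerate D) UNIV D" by (rule bij_enumerate)
  define g where "g = enumerate D"
  define F where "F x y \<longleftrightarrow> E (g x) (g y)" for x y
  have g_inv: "g (inv g x) = x" if "x \<in> D" for x
    using bij that unfolding g_def by (simp add: bij_betw_def f_inv_into_f)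
  have F: "sat UNIV F e' p \<longleftrightarrow> sat D E (\<lambda>k. g (e' k)) p" for e' p
    using sat_bij_betw[OF bij] unfolding F_def g_def .
  have "sat UNIV F e' p" if "p \<in> ZFC" for p e'
  proof -
    \<comment> \<open>The axioms are sentences, so the assignment may be exchanged.\<close>
    have "sat D E (\<lambda>k. g (e' k)) p \<longleftrightarrow> sat D E e p"
      by (rule sat_cong[OF vars_below_ZFC[OF that]]) simp
    then show ?thesis using sat that by (simp add: F)
  qed
  then have "sat UNIV F (\<lambda>k. inv g (e k)) q" by (rule assms)
  moreover have "(\<lambda>k. g (inv g (e k))) = e" using g_inv D by (auto simp: fun_eq_iff)
  ultimately have "sat D E e q" by (simp add: F)
  then show False using sat[of "Neg q"] by simp
qed

section \<open>Set theory inside a model\<close>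

text \<open>Lets the simplifier look up indices such as \<open>w + 5\<close> in nested
  assignments.\<close>

lemma case_nat_add_numeral [simp]:
  "case_nat a e (n + numeral k) = e (n + pred_numeral k)"
  by (simp add: numeral_eq_Suc)

locale set_model =
  fixes E :: "'a \<Rightarrow> 'a \<Rightarrow> bool" (infix \<open>\<epsilon>\<close> 50)
  assumes ZFC: "p \<in> ZFC \<Longrightarrow> sat UNIV E e p"
begin

abbreviation holds :: "(nat \<Rightarrow> 'a) \<Rightarrow> fm \<Rightarrow> bool" (infix \<open>\<Turnstile>\<close> 50) where
  "e \<Turnstile> p \<equiv> sat UNIV E e p"

lemma extensional: "(\<And>x. x \<epsilon> a \<longleftrightarrow> x \<epsilon> b) \<Longrightarrow> a = b"
proof -
  have "e \<Turnstile> extensionality \<longleftrightarrow> (\<forall>a b. (\<forall>x. x \<epsilon> a \<longleftrightarrow> x \<epsilon> b) \<longrightarrow> a = b)" for e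
    by (simp add: extensionality_def)
  moreover have "extensionality \<in> ZFC" by (simp add: ZFC_def)
  ultimately show "(\<And>x. x \<epsilon> a \<longleftrightarrow> x \<epsilon> b) \<Longrightarrow> a = b" using ZFC by blast
qed

text \<open>The quantifiers of a universal closure are stripped one at a time, each instantiated
  with the value that \<open>e\<close> has there.\<close>

lemma closures_elim:
  assumes "closures p \<subseteq> ZFC" shows "e \<Turnstile> p"
proof -
  obtain n where n: "vars_below p n" using ex_vars_below by blast
  have "(\<forall>e. e \<Turnstile> (All ^^ k) p) \<Longrightarrow> e \<Turnstile> p" for k
  proof (induction k arbitrary: e)
    case (Suc k)
    have "e \<Turnstile> (All ^^ k) p" for e
    proof -
      have "case_nat (e 0) (\<lambda>k. e (Suc k)) = e" by (auto split: nat.split)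
      moreover have "\<forall>a. case_nat a (\<lambda>k. e (Suc k)) \<Turnstile> (All ^^ k) p"
        using Suc.prems by simp
      ultimately show ?thesis by metis
    qed
    then show ?case by (simp add: Suc.IH)
  qed auto
  then show ?thesis using ZFC assms n unfolding closures_def by blast
qed

text \<open>The renaming in the axiom jumps over the variables for the two sets, so \<open>p\<close>
  sees only the element and the parameters in \<open>e\<close>.\<close>

lemma separation: "\<exists>b. \<forall>x. x \<epsilon> b \<longleftrightarrow> x \<epsilon> a \<and> case_nat x e \<Turnstile> p"
proof -
  have "e \<Turnstile> separation p" by (rule closures_elim) (auto simp: ZFC_def)
  moreover have "(\<lambda>k. case_nat x (case_nat b (case_nat a e)) (case_nat 0 (\<lambda>k. k + 3) k)) = case_nat x e"
    for a x b by (auto split: nat.split)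
  ultimately have "\<forall>a. \<exists>b. \<forall>x. x \<epsilon> b \<longleftrightarrow> x \<epsilon> a \<and> case_nat x e \<Turnstile> p"
    by (simp add: separation_def sat_rename)
  then show ?thesis ..
qed

lemma replacement:
  assumes "\<And>x y z. x \<epsilon> a \<Longrightarrow> case_nat y (case_nat x e) \<Turnstile> p \<Longrightarrow> case_nat z (case_nat x e) \<Turnstile> p \<Longrightarrow> y = z"
  shows "\<exists>b. \<forall>y. y \<epsilon> b \<longleftrightarrow> (\<exists>x. x \<epsilon> a \<and> case_nat y (case_nat x e) \<Turnstile> p)"
proof -
  have "e \<Turnstile> replacement p" by (rule closures_elim) (auto simp: ZFC_def)
  \<comment> \<open>One equation for each of the three renamed copies of \<open>p\<close> in the
    axiom; in the last one \<open>z\<close> is the image set.\<close>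
  moreover have
    "(\<lambda>k. case_nat z (case_nat y (case_nat x (case_nat a e))) (case_nat (Suc 0) (case_nat 2 (\<lambda>k. k + 4)) k))
      = case_nat y (case_nat x e)"
    "(\<lambda>k. case_nat z (case_nat y (case_nat x (case_nat a e))) (case_nat 0 (case_nat 2 (\<lambda>k. k + 4)) k))
      = case_nat z (case_nat x e)"
    "(\<lambda>k. case_nat x (case_nat y (case_nat z (case_nat a e))) (case_nat (Suc 0) (case_nat 0 (\<lambda>k. k + 4)) k))
      = case_nat y (case_nat x e)"
    for a x y z by (auto split: nat.split)
  ultimately have "\<forall>a. (\<forall>x. x \<epsilon> a \<longrightarrow> (\<forall>y z. case_nat y (case_nat x e) \<Turnstile> p \<and>
        case_nat z (case_nat x e) \<Turnstile> p \<longrightarrow> y = z)) \<longrightarrow>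
      (\<exists>b. \<forall>y. y \<epsilon> b \<longleftrightarrow> (\<exists>x. x \<epsilon> a \<and> case_nat y (case_nat x e) \<Turnstile> p))"
    by (simp add: replacement_def sat_rename)
  then show ?thesis using assms by blast
qed

section \<open>Basic sets, pairs and numerals of the model\<close>

definition emp :: 'a where "emp = (SOME a. \<forall>x. \<not> x \<epsilon> a)"
definition upair :: "'a \<Rightarrow> 'a \<Rightarrow> 'a" where "upair a b = (SOME c. \<forall>x. x \<epsilon> c \<longleftrightarrow> x = a \<or> x = b)"
definition sc :: "'a \<Rightarrow> 'a" where "sc a = (SOME c. \<forall>x. x \<epsilon> c \<longleftrightarrow> x \<epsilon> a \<or> x = a)"
definition pr :: "'a \<Rightarrow> 'a \<Rightarrow> 'a" where "pr a b = upair (upair a a) (upair a b)"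
definition num :: "nat \<Rightarrow> 'a" where "num n = (sc ^^ n) emp"

lemma num_simps [simp]: "num 0 = emp" "num (Suc n) = sc (num n)"
  by (simp_all add: num_def)

lemma mem_emp [simp]: "\<not> x \<epsilon> emp"
proof -
  have "\<exists>a. \<forall>x. \<not> x \<epsilon> a" using separation[of _ _ Bot] by simp
  then show ?thesis unfolding emp_def by (rule someI2_ex) auto
qed

lemma mem_upair [simp]: "x \<epsilon> upair a b \<longleftrightarrow> x = a \<or> x = b"
proof -
  have "\<exists>c. \<forall>x. x \<epsilon> c \<longleftrightarrow> x = a \<or> x = b"
    using ZFC[of pairing] by (simp add: ZFC_def pairing_def Upair_def)
  then show ?thesis unfolding upair_def by (rule someI2_ex) auto
qed

text \<open>The required set is the union of the pair of \<open>a\<close> and the singleton of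
  \<open>b\<close>.\<close>

lemma ex_insert: "\<exists>c. \<forall>x. x \<epsilon> c \<longleftrightarrow> x \<epsilon> a \<or> x = b"
proof -
  have "\<forall>c. \<exists>u. \<forall>x. x \<epsilon> u \<longleftrightarrow> (\<exists>d. d \<epsilon> c \<and> x \<epsilon> d)"
    using ZFC[of union] by (simp add: ZFC_def union_def)
  from this[rule_format, of "upair a (upair b b)"]
  obtain u where "\<And>x. x \<epsilon> u \<longleftrightarrow> (\<exists>d. d \<epsilon> upair a (upair b b) \<and> x \<epsilon> d)" by blast
  then show ?thesis by (intro exI[of _ u]) auto
qed

lemma mem_sc [simp]: "x \<epsilon> sc a \<longleftrightarrow> x \<epsilon> a \<or> x = a"
  unfolding sc_def by (rule someI2_ex[OF ex_insert]) auto

text \<open>Finiteness is meant from outside the model. This is what turns a standard halting run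
  into an element of the model.\<close>

lemma ex_finite_set: "finite X \<Longrightarrow> \<exists>c. \<forall>x. x \<epsilon> c \<longleftrightarrow> x \<in> X"
proof (induction rule: finite_induct)
  case empty
  then show ?case using mem_emp by blast
next
  case (insert y X)
  then show ?case using ex_insert by (metis insert_iff)
qed

lemma eq_iff_mem: "a = b \<longleftrightarrow> (\<forall>x. x \<epsilon> a \<longleftrightarrow> x \<epsilon> b)"
  by (auto intro: extensional)

lemma upair_eq_iff: "upair a b = upair c d \<longleftrightarrow> a = c \<and> b = d \<or> a = d \<and> b = c"
proof -
  have "upair a b = upair c d \<longleftrightarrow> {a, b} = {c, d}"
    unfolding eq_iff_mem[of "upair a b"] set_eq_iff by simp
  then show ?thesis by (simp add: doubleton_eq_iff)
qed

lemma pr_inject [simp]: "pr a b = pr c d \<longleftrightarrow> a = c \<and> b = d"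
  by (auto simp: pr_def upair_eq_iff)

text \<open>Foundation is applied to the pair of \<open>a\<close> and \<open>b\<close>, each of
  which would meet it. The case \<open>a = b\<close> gives irreflexivity.\<close>

lemma no_membership_cycle: "a \<epsilon> b \<Longrightarrow> \<not> b \<epsilon> a"
proof
  assume "a \<epsilon> b" "b \<epsilon> a"
  have "\<forall>c. (\<exists>x. x \<epsilon> c) \<longrightarrow> (\<exists>x. x \<epsilon> c \<and> \<not> (\<exists>y. y \<epsilon> x \<and> y \<epsilon> c))"
    using ZFC[of foundation] by (simp add: ZFC_def foundation_def)
  from this[rule_format, of "upair a b"] show False using \<open>a \<epsilon> b\<close> \<open>b \<epsilon> a\<close> by auto
qed

lemma mem_irrefl [simp]: "\<not> a \<epsilon> a"
  using no_membership_cycle by blast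

lemma sc_inject [simp]: "sc a = sc b \<longleftrightarrow> a = b"
proof
  assume eq: "sc a = sc b"
  have "a \<epsilon> sc b" "b \<epsilon> sc a" using mem_sc[of a a] mem_sc[of b b] eq by metis+
  then show "a = b" using no_membership_cycle[of a b] by auto
qed simp

lemma sc_not_emp [simp]: "sc a \<noteq> emp" "emp \<noteq> sc a"
proof -
  have "a \<epsilon> sc a" by simp
  then show "sc a \<noteq> emp" "emp \<noteq> sc a" using mem_emp[of a] by metis+
qed

lemma num_inject [simp]: "num i = num j \<longleftrightarrow> i = j"
proof (induction i arbitrary: j)
  case 0
  then show ?case by (cases j) auto
next
  case (Suc i)
  then show ?case by (cases j) auto
qed

lemma mem_num: "x \<epsilon> num n \<longleftrightarrow> (\<exists>i<n. x = num i)"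
  by (induction n) (auto simp: less_Suc_eq)

lemma num_mem_num [simp]: "num i \<epsilon> num j \<longleftrightarrow> i < j"
  by (auto simp: mem_num)

lemma sat_sets [simp]:
  "e \<Turnstile> Empty x \<longleftrightarrow> e x = emp"
  "e \<Turnstile> Succ x y \<longleftrightarrow> e y = sc (e x)"
  "e \<Turnstile> Upair x y z \<longleftrightarrow> e z = upair (e x) (e y)"
  "e \<Turnstile> Subset x y \<longleftrightarrow> (\<forall>a. a \<epsilon> e x \<longrightarrow> a \<epsilon> e y)"
  by (simp_all add: Empty_def Succ_def Upair_def Subset_def eq_iff_mem[of "e x" emp]
      eq_iff_mem[of "e y" "sc (e x)"] eq_iff_mem[of "e z" "upair (e x) (e y)"])

lemma sat_Num [simp]: "e \<Turnstile> Num n x \<longleftrightarrow> e x = num n"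
  by (induction n arbitrary: e x) auto

lemma sat_pairs [simp]:
  "e \<Turnstile> Pair x y z \<longleftrightarrow> e z = pr (e x) (e y)"
  "e \<Turnstile> App f x y \<longleftrightarrow> pr (e x) (e y) \<epsilon> e f"
  "e \<Turnstile> Config x y z c \<longleftrightarrow> e c = pr (e x) (pr (e y) (e z))"
  "e \<Turnstile> App_Num f x k \<longleftrightarrow> pr (e x) (num k) \<epsilon> e f"
  "e \<Turnstile> App_Num_Num f i k \<longleftrightarrow> pr (num i) (num k) \<epsilon> e f"
proof -
  show *: "e \<Turnstile> Pair x y z \<longleftrightarrow> e z = pr (e x) (e y)" for e x y z
    by (simp add: Pair_def pr_def)
  show **: "e \<Turnstile> App f x y \<longleftrightarrow> pr (e x) (e y) \<epsilon> e f" for e f x y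
    by (simp add: App_def *)
  show "e \<Turnstile> Config x y z c \<longleftrightarrow> e c = pr (e x) (pr (e y) (e z))"
    by (simp add: Config_def *)
  show ***: "e \<Turnstile> App_Num f x k \<longleftrightarrow> pr (e x) (num k) \<epsilon> e f" for e f x k
    by (simp add: App_Num_def **)
  show "e \<Turnstile> App_Num_Num f i k \<longleftrightarrow> pr (num i) (num k) \<epsilon> e f"
    by (simp add: App_Num_Num_def ***)
qed

section \<open>Functions inside the model\<close>

definition function_on :: "'a \<Rightarrow> 'a \<Rightarrow> bool" where
  "function_on f a \<longleftrightarrow> (\<forall>z. z \<epsilon> f \<longrightarrow> (\<exists>x y. z = pr x y)) \<and> (\<forall>x. x \<epsilon> a \<longleftrightarrow> (\<exists>y. pr x y \<epsilon> f)) \<and>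
     (\<forall>x y z. pr x y \<epsilon> f \<and> pr x z \<epsilon> f \<longrightarrow> y = z)"

definition maps :: "'a \<Rightarrow> 'a \<Rightarrow> 'a \<Rightarrow> bool" where
  "maps f a b \<longleftrightarrow> function_on f a \<and> (\<forall>x y. pr x y \<epsilon> f \<longrightarrow> y \<epsilon> b)"

lemma sat_functions [simp]:
  "e \<Turnstile> Function f x \<longleftrightarrow> function_on (e f) (e x)"
  "e \<Turnstile> Maps f x y \<longleftrightarrow> maps (e f) (e x) (e y)"
  by (simp_all add: Function_def function_on_def Maps_def maps_def)

text \<open>The graph is the image of \<open>a\<close> under the formula that assigns to
  \<open>x\<close> the pair of \<open>x\<close> and its value. The values have to be given by a
  formula, as replacement demands.\<close>

lemma ex_function:
  assumes "\<And>x. x \<epsilon> a \<Longrightarrow> \<exists>!y. case_nat y (case_nat x e) \<Turnstile> p"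
  obtains f where "function_on f a"
    "\<And>x y. pr x y \<epsilon> f \<longleftrightarrow> x \<epsilon> a \<and> case_nat y (case_nat x e) \<Turnstile> p"
proof -
  \<comment> \<open>Below the quantifier, index 0 is the value, 1 the pair and 2 the argument; the
    parameters of \<open>p\<close> begin at 3.\<close>
  define q where "q = Ex (And (Pair 2 0 1) (rename p (case_nat 0 (case_nat 2 (\<lambda>k. k + 3)))))"
  have q: "case_nat z (case_nat x e) \<Turnstile> q \<longleftrightarrow> (\<exists>y. z = pr x y \<and> case_nat y (case_nat x e) \<Turnstile> p)"
    for z x
  proof -
    have "(\<lambda>k. case_nat y (case_nat z (case_nat x e)) (case_nat 0 (case_nat 2 (\<lambda>k. k + 3)) k))
      = case_nat y (case_nat x e)" for y by (auto split: nat.split)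
    then show ?thesis by (simp add: q_def sat_rename)
  qed
  obtain f where f: "\<And>z. z \<epsilon> f \<longleftrightarrow> (\<exists>x. x \<epsilon> a \<and> case_nat z (case_nat x e) \<Turnstile> q)"
    using replacement[of a e q] assms unfolding q by blast
  have "pr x y \<epsilon> f \<longleftrightarrow> x \<epsilon> a \<and> case_nat y (case_nat x e) \<Turnstile> p" for x y
    by (auto simp: f q)
  moreover have "function_on f a"
    unfolding function_on_def using assms by (auto simp: f q) blast+
  ultimately show thesis using that by blast
qed

section \<open>The natural numbers of the model\<close>

definition is_inductive :: "'a \<Rightarrow> bool" where
  "is_inductive a \<longleftrightarrow> emp \<epsilon> a \<and> (\<forall>x. x \<epsilon> a \<longrightarrow> sc x \<epsilon> a)"

lemma sat_Inductive [simp]: "e \<Turnstile> Inductive x \<longleftrightarrow> is_inductive (e x)"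
  by (simp add: Inductive_def is_inductive_def)

definition is_omega :: "'a \<Rightarrow> bool" where
  "is_omega w \<longleftrightarrow> is_inductive w \<and> (\<forall>a. is_inductive a \<longrightarrow> (\<forall>x. x \<epsilon> w \<longrightarrow> x \<epsilon> a))"

lemma sat_Omega [simp]: "e \<Turnstile> Omega x \<longleftrightarrow> is_omega (e x)"
  by (simp add: Omega_def is_omega_def)

text \<open>Separation cuts the intersection of all inductive sets out of one inductive set.\<close>

lemma ex_omega: "\<exists>w. is_omega w"
proof -
  obtain a where a: "is_inductive a"
    using ZFC[of infinity] by (auto simp: ZFC_def infinity_def)
  obtain w where w: "\<And>x. x \<epsilon> w \<longleftrightarrow> x \<epsilon> a \<and> (\<forall>b. is_inductive b \<longrightarrow> x \<epsilon> b)"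
    using separation[of a _ "All (Imp (Inductive 0) (Mem 1 0))"] by auto
  have "is_inductive w"
    unfolding is_inductive_def[of w] w using a by (auto simp: is_inductive_def)
  then have "is_omega w" by (simp add: is_omega_def w)
  then show ?thesis ..
qed

end

locale omega_model = set_model +
  fixes \<omega> :: 'a
  assumes omega: "is_omega \<omega>"
begin

lemma is_inductive_omega: "is_inductive \<omega>"
  using omega by (simp add: is_omega_def)

text \<open>Separation forms the set of all \<open>x\<close> satisfying \<open>p\<close>, and this
  set is inductive. Induction therefore covers properties given by formulas, whereas being a
  standard numeral is in general not one of them.\<close>

lemma omega_induct:
  assumes "x \<epsilon> \<omega>" and "case_nat emp e \<Turnstile> p"
    and "\<And>x. x \<epsilon> \<omega> \<Longrightarrow> case_nat x e \<Turnstile> p \<Longrightarrow> case_nat (sc x) e \<Turnstile> p"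
  shows "case_nat x e \<Turnstile> p"
proof -
  obtain b where b: "\<And>x. x \<epsilon> b \<longleftrightarrow> x \<epsilon> \<omega> \<and> case_nat x e \<Turnstile> p"
    using separation[of \<omega> e p] by blast
  have "is_inductive b"
    using assms(2,3) is_inductive_omega by (simp add: is_inductive_def b)
  then have "x \<epsilon> b" using assms(1) omega by (simp add: is_omega_def)
  then show ?thesis by (simp add: b)
qed

lemma num_mem_omega [simp]: "num n \<epsilon> \<omega>"
  using is_inductive_omega by (induction n) (simp_all add: is_inductive_def)

lemma omega_cases:
  assumes "x \<epsilon> \<omega>" shows "x = emp \<or> (\<exists>y. y \<epsilon> \<omega> \<and> x = sc y)"
proof -
  have "case_nat x (\<lambda>_. \<omega>) \<Turnstile> Or (Empty 0) (BEx 1 (Succ 0 1))"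
    by (rule omega_induct[OF assms]) auto
  then show ?thesis by auto
qed

lemma emp_mem_omega:
  assumes "x \<epsilon> \<omega>" shows "x = emp \<or> emp \<epsilon> x"
proof -
  have "case_nat x (\<lambda>_. emp) \<Turnstile> Or (Empty 0) (Mem 1 0)"
    by (rule omega_induct[OF assms]) auto
  then show ?thesis by simp
qed

lemma sc_mem_omega:
  assumes "x \<epsilon> \<omega>" "y \<epsilon> x" shows "sc y = x \<or> sc y \<epsilon> x"
proof -
  have "case_nat x (\<lambda>_. y) \<Turnstile> Imp (Mem 1 0) (Or (Succ 1 0) (Ex (And (Succ 2 0) (Mem 0 1))))"
    by (rule omega_induct[OF assms(1)]) auto
  then show ?thesis using assms(2) by auto
qed

text \<open>External induction on \<open>k\<close>: once \<open>num j\<close> lies in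
  \<open>x\<close>, its successor equals \<open>x\<close> or lies in \<open>x\<close>. A nonstandard
  \<open>x\<close> always falls under the second alternative.\<close>

lemma omega_standard_or_large:
  assumes "x \<epsilon> \<omega>" shows "(\<exists>i<k. x = num i) \<or> (\<forall>i<k. num i \<epsilon> x)"
proof (induction k)
  case (Suc k)
  show ?case
  proof (cases k)
    case 0
    then show ?thesis using emp_mem_omega[OF assms] by auto
  next
    case (Suc j)
    then show ?thesis
      using Suc.IH sc_mem_omega[OF assms, of "num j"] by (auto simp: less_Suc_eq)
  qed
qed auto

end

section \<open>Runs of a Turing machine\<close>

lemma run_simps [simp]:
  "run M s 0 = (start M, 0, initial_tape s)"
  "run M s (Suc n) = step M (run M s n)"
  by (simp_all add: run_def)

lemma step_unfold:
  "step M c = (case delta M (fst c) (snd (snd c) (fst (snd c))) of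
     (q, b, m) \<Rightarrow> (q, move m (fst (snd c)), (snd (snd c))(fst (snd c) := b)))"
  by (cases c) simp

lemma move_le: "move m h \<le> Suc h"
  by (cases m) auto

lemma head_le: "fst (snd (run M s n)) \<le> n"
proof (induction n)
  case (Suc n)
  then show ?case
    by (auto simp: step_unfold split: prod.split intro: order_trans[OF move_le])
qed auto

lemma run_state: "turing_machine M \<Longrightarrow> fst (run M s n) \<in> states M"
  by (induction n) (auto simp: turing_machine_def step_unfold split: prod.split, metis fst_conv)

text \<open>Halting configurations are fixed by \<open>step\<close>, since the halting state
  rewrites the scanned symbol and stays.\<close>

lemma run_halted:
  assumes "turing_machine M" "halts_at M s n" "n \<le> m"
  shows "run M s m = run M s n"
  using assms(3)
proof (induction m rule: dec_induct)
  case (step m)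
  obtain h t where "run M s n = (halt M, h, t)"
    using assms(2) by (metis halts_at_def prod.collapse)
  then show ?case using step.IH assms(1) by (simp add: turing_machine_def)
qed simp

text \<open>During the first \<open>n\<close> steps the head stays within the cells up to
  \<open>b\<close>, so both runs read the same symbols and make the same changes.\<close>

lemma run_agree:
  assumes "\<And>i. i \<le> b \<Longrightarrow> initial_tape r i = initial_tape s i" and "n \<le> b"
  shows "fst (run M r n) = fst (run M s n)" "fst (snd (run M r n)) = fst (snd (run M s n))"
    "\<And>i. i \<le> b \<Longrightarrow> snd (snd (run M r n)) i = snd (snd (run M s n)) i"
proof -
  have "fst (run M r n) = fst (run M s n) \<and> fst (snd (run M r n)) = fst (snd (run M s n)) \<and>
    (\<forall>i\<le>b. snd (snd (run M r n)) i = snd (snd (run M s n)) i)"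
    using assms(2)
  proof (induction n)
    case 0
    then show ?case using assms(1) by simp
  next
    case (Suc n)
    have "fst (snd (run M s n)) \<le> b" using head_le[of M s n] Suc.prems by simp
    then show ?case using Suc by (simp add: step_unfold split: prod.split)
  qed
  then show "fst (run M r n) = fst (run M s n)" "fst (snd (run M r n)) = fst (snd (run M s n))"
    "\<And>i. i \<le> b \<Longrightarrow> snd (snd (run M r n)) i = snd (snd (run M s n)) i" by auto
qed

text \<open>Ensures that the \<open>LEAST\<close> in \<open>tape_output\<close> is attained.\<close>

lemma run_tape_eventually_blank: "\<exists>b. \<forall>i\<ge>b. snd (snd (run M s n)) i = Blank"
proof (induction n)
  case 0
  then show ?case by (auto simp: initial_tape_def intro!: exI[of _ "Suc (length s)"])
next
  case (Suc n)
  then obtain b where "\<forall>i\<ge>b. snd (snd (run M s n)) i = Blank" by blast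
  then show ?case
    by (intro exI[of _ "max b (Suc (fst (snd (run M s n))))"])
      (auto simp: step_unfold split: prod.split)
qed

lemma halts_at_steps:
  assumes "halts_on_all_inputs M" shows "halts_at M s (steps M s)"
  using assms unfolding halts_on_all_inputs_def steps_def by (metis LeastI)

lemma steps_le_time_complexity: "steps M s \<le> time_complexity M (length s)"
proof -
  have "finite {r :: bool list. length r = length s}"
    using finite_lists_length_eq[of "UNIV :: bool set"] by simp
  then show ?thesis unfolding time_complexity_def by (intro Max_ge) (auto simp: setcompr_eq_image)
qed

text \<open>On the prefix of length \<open>K\<close> the machine halts after fewer than
  \<open>K\<close> steps. The cells up to \<open>K\<close> carry the same symbols for
  \<open>r\<close>, so the run on \<open>r\<close> halts at the same time.\<close>

lemma halts_before_reading_tail: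
  assumes "halts_on_all_inputs M" "time_complexity M K < K" "K \<le> length r"
  shows "\<exists>n<K. halts_at M r n"
proof -
  let ?p = "take K r" and ?n = "steps M (take K r)"
  have n: "?n < K" using steps_le_time_complexity[of M ?p] assms by simp
  have "fst (run M ?p ?n) = fst (run M r ?n)"
    by (rule run_agree[where b = K]) (use assms n in \<open>auto simp: initial_tape_def\<close>)
  then show ?thesis using halts_at_steps[OF assms(1), of ?p] n by (auto simp: halts_at_def)
qed

text \<open>The halting time hidden in \<open>outputs\<close> may differ from \<open>n\<close>, but
  the configurations coincide. An output of length 1 forces the first non-binary cell to be cell
  2.\<close>

lemma output_True_cells:
  assumes M: "turing_machine M" and out: "outputs M s [True]" and halt: "halts_at M s n"
  shows "snd (snd (run M s n)) 1 = One" "snd (snd (run M s n)) 2 \<notin> {Zero, One}"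
proof -
  obtain m where m: "halts_at M s m" "tape_output (snd (snd (run M s m))) = [True]"
    using out unfolding outputs_def by blast
  have "run M s m = run M s n"
    using run_halted[OF M m(1), of n] run_halted[OF M halt, of m] by (metis nat_le_linear)
  define t where "t = snd (snd (run M s n))"
  define l where "l = (LEAST k. 1 \<le> k \<and> t k \<notin> {Zero, One})"
  have t: "map (\<lambda>i. t i = One) [1..<l] = [True]"
    using m(2) \<open>run M s m = run M s n\<close> by (simp add: tape_output_def t_def l_def)
  then have "length [1..<l] = 1" by (metis length_map length_Cons list.size(3) One_nat_def)
  then have l: "l = 2" by simp
  obtain b where "\<forall>i\<ge>b. t i = Blank" unfolding t_def using run_tape_eventually_blank by blast
  then have "1 \<le> Suc b \<and> t (Suc b) \<notin> {Zero, One}" by simp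
  then have "1 \<le> l \<and> t l \<notin> {Zero, One}" unfolding l_def by (rule LeastI)
  then show "snd (snd (run M s n)) 2 \<notin> {Zero, One}" by (simp add: l t_def)
  show "snd (snd (run M s n)) 1 = One" using t unfolding l by (simp add: t_def upt_rec)
qed

section \<open>Runs inside a model\<close>

context omega_model
begin

declare num_simps [simp del]

lemma sat_strings [simp]:
  "e \<Turnstile> Tape x y \<longleftrightarrow> maps (e y) (e x) (num 4)"
  "e \<Turnstile> Binary_String x y \<longleftrightarrow> (\<exists>n. n \<epsilon> e x \<and> maps (e y) n (num 2))"
  by (simp_all add: Tape_def Binary_String_def)

lemma sat_Initial_Tape:
  "e \<Turnstile> Initial_Tape x y z \<longleftrightarrow> maps (e z) (e x) (num 4) \<and> pr (num 0) (num 3) \<epsilon> e z \<and>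
     (\<forall>i. i \<epsilon> e x \<longrightarrow> (\<forall>a. pr i a \<epsilon> e y \<longrightarrow> pr (sc i) a \<epsilon> e z) \<and>
        ((\<forall>a. \<not> pr i a \<epsilon> e y) \<longrightarrow> pr (sc i) (num 2) \<epsilon> e z))"
  by (simp add: Initial_Tape_def)

text \<open>Every element of \<omega> is empty or a successor, which makes the definition by these
  two cases single-valued and total.\<close>

lemma ex_initial_tape:
  assumes s: "maps s n (num 2)"
  obtains t where "maps t \<omega> (num 4)" "pr (num 0) (num 3) \<epsilon> t"
    "\<And>i y. i \<epsilon> \<omega> \<Longrightarrow> pr (sc i) y \<epsilon> t \<longleftrightarrow> pr i y \<epsilon> s \<or> (\<forall>a. \<not> pr i a \<epsilon> s) \<and> y = num 2"
proof -
  \<comment> \<open>Index 0 is the symbol, 1 the cell and every later one \<open>s\<close>; under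
    the quantifier 0 is the predecessor of the cell. The codes 3 and 2 are the marker and the
    blank.\<close>
  define p where "p = Or (And (Empty 1) (Num 3 0))
    (Ex (And (Succ 0 2) (Or (App 3 0 1) (And (Neg (Ex (App 4 1 0))) (Num 2 1)))))"
  define P where "P x y \<longleftrightarrow> x = emp \<and> y = num 3 \<or>
    (\<exists>i. x = sc i \<and> (pr i y \<epsilon> s \<or> (\<forall>a. \<not> pr i a \<epsilon> s) \<and> y = num 2))" for x y
  have p: "case_nat y (case_nat x (\<lambda>_. s)) \<Turnstile> p \<longleftrightarrow> P x y" for x y
    by (simp add: p_def P_def)
  have P_emp: "P emp y \<longleftrightarrow> y = num 3" for y by (simp add: P_def)
  have P_sc: "P (sc i) y \<longleftrightarrow> pr i y \<epsilon> s \<or> (\<forall>a. \<not> pr i a \<epsilon> s) \<and> y = num 2" for i y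
    by (simp add: P_def)
  have unique: "\<exists>!y. P x y" if x: "x \<epsilon> \<omega>" for x
  proof -
    consider "x = emp" | i where "x = sc i" using omega_cases[OF x] by blast
    then show ?thesis
    proof cases
      case 2
      have "y = z" if "pr i y \<epsilon> s" "pr i z \<epsilon> s" for y z
        using s that unfolding maps_def function_on_def by blast
      then show ?thesis unfolding 2 P_sc by blast
    qed (simp add: P_emp)
  qed
  obtain t where t: "function_on t \<omega>" "\<And>x y. pr x y \<epsilon> t \<longleftrightarrow> x \<epsilon> \<omega> \<and> P x y"
    using ex_function[of \<omega> "\<lambda>_. s" p] unique unfolding p by blast
  have sc: "sc i \<epsilon> \<omega>" if "i \<epsilon> \<omega>" for i
    using is_inductive_omega that by (simp add: is_inductive_def)
  show thesis
  proof
    show "pr (num 0) (num 3) \<epsilon> t" 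
      using num_mem_omega[of 0] by (simp add: t(2) num_simps P_emp)
    show "pr (sc i) y \<epsilon> t \<longleftrightarrow> pr i y \<epsilon> s \<or> (\<forall>a. \<not> pr i a \<epsilon> s) \<and> y = num 2" if "i \<epsilon> \<omega>" for i y
      using that sc by (simp add: t(2) P_sc)
    have "y \<epsilon> num 4" if "P x y" for x y
    proof -
      have "y \<epsilon> num 2" if "pr i y \<epsilon> s" for i using s that by (auto simp: maps_def)
      then have "y = num 3 \<or> y = num 2 \<or> y \<epsilon> num 2" using that by (auto simp: P_def)
      then show ?thesis by (auto simp: mem_num)
    qed
    then show "maps t \<omega> (num 4)" using t by (auto simp: maps_def)
  qed
qed

text \<open>The model's tape has nonstandard cells and may hold a string of nonstandard length, so it
  is compared with the standard tape only on the cells up to \<open>b\<close>.\<close>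

definition represents :: "'q list \<Rightarrow> nat \<Rightarrow> 'q config \<Rightarrow> 'a \<Rightarrow> bool" where
  "represents qs b = (\<lambda>(q, h, t) c. \<exists>u. maps u \<omega> (num 4) \<and>
     c = pr (num (state_code qs q)) (pr (num h) u) \<and>
     (\<forall>i\<le>b. pr (num i) (num (sym_code (t i))) \<epsilon> u))"

lemma sat_Move:
  assumes "e x = num h" "e y = num (move m h)"
  shows "e \<Turnstile> Move m x y"
proof (cases m)
  case MoveL
  then show ?thesis using assms by (cases h) (simp_all add: num_simps)
qed (use assms in \<open>simp_all add: num_simps\<close>)

text \<open>The case distinction at cell \<open>h\<close> is a formula with parameters
  \<open>h\<close>, \<open>a\<close> and \<open>t\<close>, so \<open>ex_function\<close> supplies
  the new tape.\<close>

lemma ex_tape_update: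
  assumes t: "maps t \<omega> (num 4)" and a: "a \<epsilon> num 4"
  obtains u where "maps u \<omega> (num 4)"
    "\<And>x y. pr x y \<epsilon> u \<longleftrightarrow> x \<epsilon> \<omega> \<and> (if x = h then y = a else pr x y \<epsilon> t)"
proof -
  define p where "p = Or (And (Eq 1 2) (Eq 0 3)) (And (Neg (Eq 1 2)) (App 4 1 0))"
  define e where "e = case_nat h (case_nat a (\<lambda>_. t))"
  have p: "case_nat y (case_nat x e) \<Turnstile> p \<longleftrightarrow> (if x = h then y = a else pr x y \<epsilon> t)" for x y
    by (simp add: p_def e_def)
  have "\<exists>!y. if x = h then y = a else pr x y \<epsilon> t" if "x \<epsilon> \<omega>" for x
  proof (cases "x = h")
    case False
    then show ?thesis using t that unfolding maps_def function_on_def by (simp; blast)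
  qed simp
  then obtain u where u: "function_on u \<omega>"
    "\<And>x y. pr x y \<epsilon> u \<longleftrightarrow> x \<epsilon> \<omega> \<and> (if x = h then y = a else pr x y \<epsilon> t)"
    using ex_function[of \<omega> e p] unfolding p by blast
  then have "maps u \<omega> (num 4)" using t a by (auto simp: maps_def)
  with u(2) show thesis using that by blast
qed

lemma sym_code_less: "sym_code a < 4"
  by (cases a) auto

text \<open>Since \<open>h \<le> b\<close>, the model's tape carries the code of the scanned symbol
  at the head, so the disjunct of \<open>Step\<close> for \<open>q\<close> and \<open>t h\<close>
  holds with the updated tape.\<close>

lemma represents_step:
  assumes c: "represents qs b (q, h, t) c" and "h \<le> b" "q \<in> set qs"
  shows "\<exists>d. represents qs b (step M (q, h, t)) d \<and>
    (\<forall>e w x y. e w = \<omega> \<and> e x = c \<and> e y = d \<longrightarrow> e \<Turnstile> Step qs M w x y)"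
proof -
  obtain u where u: "maps u \<omega> (num 4)" "c = pr (num (state_code qs q)) (pr (num h) u)"
    "\<And>i. i \<le> b \<Longrightarrow> pr (num i) (num (sym_code (t i))) \<epsilon> u"
    using c by (auto simp: represents_def)
  obtain q' a m where d: "delta M q (t h) = (q', a, m)" by (metis prod_cases3)
  obtain v where v: "maps v \<omega> (num 4)"
    "\<And>x y. pr x y \<epsilon> v \<longleftrightarrow> x \<epsilon> \<omega> \<and> (if x = num h then y = num (sym_code a) else pr x y \<epsilon> u)"
    using ex_tape_update[OF u(1), of "num (sym_code a)" "num h"] sym_code_less by auto
  let ?d = "pr (num (state_code qs q')) (pr (num (move m h)) v)"
  have "represents qs b (step M (q, h, t)) ?d"
    using u(3) v by (auto simp: represents_def d)
  moreover have "e \<Turnstile> Step qs M w x y" if e: "e w = \<omega>" "e x = c" "e y = ?d" for e w x y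
  proof -
    \<comment> \<open>The six witnesses of \<open>Step\<close>, from the new tape at index 0 up to
      the old state at index 5.\<close>
    let ?e = "case_nat v (case_nat (num (move m h)) (case_nat (num (state_code qs q'))
       (case_nat u (case_nat (num h) (case_nat (num (state_code qs q)) e)))))"
    define C where "C q a = (case delta M q a of (q', b, m) \<Rightarrow> Conj
              [Num (state_code qs q) 5, App_Num 3 4 (sym_code a), Num (state_code qs q') 2,
               App_Num 0 4 (sym_code b), Move m 4 1])" for q a
    have mv: "?e \<Turnstile> Move m 4 1" by (rule sat_Move) auto
    have "?e \<Turnstile> C q (t h)"
      unfolding C_def d using mv u(3)[of h] v(2) \<open>h \<le> b\<close> by simp
    then have disj: "\<exists>p\<in>set [C q a. q \<leftarrow> qs, a \<leftarrow> [Zero, One, Blank, Mark]]. ?e \<Turnstile> p"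
      using \<open>q \<in> set qs\<close> by (intro bexI[of _ "C q (t h)"]) (cases "t h"; auto)+
    show ?thesis
      unfolding Step_def C_def[symmetric] sat_connectives
      apply (rule bexI[where x = "num (state_code qs q)", OF _ UNIV_I])
      apply (rule bexI[where x = "num h", OF _ UNIV_I])
      apply (rule bexI[where x = u, OF _ UNIV_I])
      apply (rule bexI[where x = "num (state_code qs q')", OF _ UNIV_I])
      apply (rule bexI[where x = "num (move m h)", OF _ UNIV_I])
      apply (rule bexI[where x = v, OF _ UNIV_I])
      using disj e u v by (simp add: sat_Disj)
  qed
  ultimately show ?thesis by blast
qed

text \<open>Up to the length of \<open>r\<close> both tapes show the common prefix. Cells beyond it
  are considered only if \<open>s\<close> has the same length as \<open>r\<close>, and then both
  tapes are blank there.\<close>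

lemma initial_tape_agrees:
  assumes s: "maps s n (num 2)"
    and r: "\<And>j. j < length r \<Longrightarrow> num j \<epsilon> n \<and> (r ! j \<longleftrightarrow> pr (num j) (num 1) \<epsilon> s)"
    and b: "b \<le> length r \<or> n = num (length r)" and "i \<le> b"
    and t0: "pr (num 0) (num 3) \<epsilon> t"
    and t: "\<And>i y. i \<epsilon> \<omega> \<Longrightarrow>
      pr (sc i) y \<epsilon> t \<longleftrightarrow> pr i y \<epsilon> s \<or> (\<forall>a. \<not> pr i a \<epsilon> s) \<and> y = num 2"
  shows "pr (num i) (num (sym_code (initial_tape r i))) \<epsilon> t"
proof (cases i)
  case 0
  then show ?thesis using t0 by (simp add: initial_tape_def)
next
  case (Suc j)
  have dom: "x \<epsilon> n \<longleftrightarrow> (\<exists>y. pr x y \<epsilon> s)" for x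
    using s unfolding maps_def function_on_def by blast
  show ?thesis
  proof (cases "j < length r")
    case True
    then obtain y where y: "pr (num j) y \<epsilon> s" using r dom by blast
    then have "y \<epsilon> num 2" using s by (auto simp: maps_def)
    then obtain k where k: "k < 2" "y = num k" by (auto simp: mem_num)
    \<comment> \<open>The only values of \<open>s\<close> are 0 and 1, so a value other than 1 is
      0.\<close>
    have "pr (num j) (num (if r ! j then 1 else 0)) \<epsilon> s"
    proof (cases "r ! j")
      case True
      then show ?thesis using r[OF \<open>j < length r\<close>] by simp
    next
      case False
      then have "k \<noteq> 1" using r[OF \<open>j < length r\<close>] y k by auto
      then have "k = 0" using k by simp
      then show ?thesis using False y k by simp
    qed
    moreover have "sym_code (initial_tape r i) = (if r ! j then 1 else 0)"
      using True by (simp add: initial_tape_def Suc)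
    ultimately show ?thesis using t[of "num j"] by (simp add: Suc num_simps(2))
  next
    case False
    then have "n = num (length r)" using b \<open>i \<le> b\<close> Suc by auto
    then have "\<forall>a. \<not> pr (num j) a \<epsilon> s" using False dom[of "num j"] by simp
    moreover have "sym_code (initial_tape r i) = 2" using False by (simp add: initial_tape_def Suc)
    ultimately show ?thesis using t[of "num j"] by (simp add: Suc num_simps(2))
  qed
qed

text \<open>If the length of \<open>s\<close> is a numeral below \<open>K\<close>, the whole of
  \<open>s\<close> is read off; otherwise its first \<open>K\<close> bits are.\<close>

lemma ex_standard_prefix:
  assumes s: "maps s n (num 2)" and n: "n \<epsilon> \<omega>"
  obtains r :: "bool list" where "length r \<le> K" "length r = K \<or> n = num (length r)"
    "\<And>j. j < length r \<Longrightarrow> num j \<epsilon> n \<and> (r ! j \<longleftrightarrow> pr (num j) (num 1) \<epsilon> s)"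
proof -
  define r where "r l = map (\<lambda>j. pr (num j) (num 1) \<epsilon> s) [0..<l]" for l
  consider i where "i < K" "n = num i" | "\<forall>i<K. num i \<epsilon> n"
    using omega_standard_or_large[OF n] by blast
  then show thesis
  proof cases
    case 1
    then show ?thesis by (intro that[of "r i"]) (simp_all add: r_def)
  next
    case 2
    then show ?thesis by (intro that[of "r K"]) (simp_all add: r_def)
  qed
qed

text \<open>The bound \<open>b\<close> limits the cells on which model and standard tape are
  compared: \<open>N \<le> b\<close> covers all cells the run visits, and \<open>2 \<le> b\<close>
  covers those that decide the output.\<close>

lemma sat_Outputs_1:
  assumes M: "turing_machine M" and qs: "set qs = states M"
    and s: "maps s n (num 2)" and ew: "e w = \<omega>" and ex: "e x = s"
    and r: "\<And>j. j < length r \<Longrightarrow> num j \<epsilon> n \<and> (r ! j \<longleftrightarrow> pr (num j) (num 1) \<epsilon> s)"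
    and b: "b \<le> length r \<or> n = num (length r)"
    and N: "halts_at M r N" "N \<le> b" "2 \<le> b" and out: "outputs M r [True]"
  shows "e \<Turnstile> Outputs_1 qs M w x"
proof -
  obtain t where t: "maps t \<omega> (num 4)" "pr (num 0) (num 3) \<epsilon> t"
    "\<And>i y. i \<epsilon> \<omega> \<Longrightarrow> pr (sc i) y \<epsilon> t \<longleftrightarrow> pr i y \<epsilon> s \<or> (\<forall>a. \<not> pr i a \<epsilon> s) \<and> y = num 2"
    by (rule ex_initial_tape[OF s]; blast)
  define c0 where "c0 = pr (num (state_code qs (start M))) (pr (num 0) t)"
  have c0: "represents qs b (run M r 0) c0"
    unfolding represents_def using t(1) initial_tape_agrees[OF s r b _ t(2,3)]
    by (auto simp: c0_def)
  \<comment> \<open>All assignments are allowed, so that the formula can be used below any number of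
    quantifiers.\<close>
  define stp where "stp c d \<longleftrightarrow> (\<forall>e w x y. e w = \<omega> \<and> e x = c \<and> e y = d \<longrightarrow> e \<Turnstile> Step qs M w x y)"
    for c d
  have next_ex: "\<exists>d. represents qs b (run M r (Suc i)) d \<and> stp c d"
    if "represents qs b (run M r i) c" "i \<le> b" for i c
  proof -
    obtain q h u where c: "run M r i = (q, h, u)" by (metis prod_cases3)
    have "h \<le> b" using head_le[of M r i] that(2) by (simp add: c)
    moreover have "q \<in> set qs" using run_state[OF M, of r i] by (simp add: c qs)
    ultimately show ?thesis using represents_step[of qs b q h u c M] that(1)
      unfolding stp_def by (simp add: c)
  qed
  \<comment> \<open>The model's configurations are chosen externally one after another. The claims
    stop at \<open>b\<close>, beyond which the head may leave the compared cells.\<close>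
  have "\<exists>C. \<forall>i. (i \<le> b \<longrightarrow> represents qs b (run M r i) (C i)) \<and> (i = 0 \<longrightarrow> C i = c0) \<and>
      (i < b \<longrightarrow> stp (C i) (C (Suc i)))"
  proof -
    have "\<exists>C. \<forall>i. ((i \<le> b \<longrightarrow> represents qs b (run M r i) (C i)) \<and> (i = 0 \<longrightarrow> C i = c0)) \<and>
        (i < b \<longrightarrow> stp (C i) (C (Suc i)))"
    proof (rule dependent_nat_choice)
      show "\<exists>c. (0 \<le> b \<longrightarrow> represents qs b (run M r 0) c) \<and> (0 = (0::nat) \<longrightarrow> c = c0)"
        using c0 by blast
    next
      fix c i
      assume "(i \<le> b \<longrightarrow> represents qs b (run M r i) c) \<and> (i = 0 \<longrightarrow> c = c0)"
      then show "\<exists>d. ((Suc i \<le> b \<longrightarrow> represents qs b (run M r (Suc i)) d) \<and>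
          (Suc i = 0 \<longrightarrow> d = c0)) \<and> (i < b \<longrightarrow> stp c d)"
        using next_ex[of i c] by (cases "i < b") auto
    qed
    then show ?thesis by blast
  qed
  then obtain C where C: "\<And>i. i \<le> b \<Longrightarrow> represents qs b (run M r i) (C i)" "C 0 = c0"
    "\<And>i. i < b \<Longrightarrow> stp (C i) (C (Suc i))" by blast
  \<comment> \<open>The run consists of \<open>N + 1\<close> pairs, a finite set from outside, and
    so it is an element of the model.\<close>
  obtain f where f: "\<And>z. z \<epsilon> f \<longleftrightarrow> z \<in> (\<lambda>i. pr (num i) (C i)) ` {..N}"
    using ex_finite_set[of "(\<lambda>i. pr (num i) (C i)) ` {..N}"] by auto
  have f_app: "pr (num i) (C i) \<epsilon> f" if "i \<le> N" for i using that by (auto simp: f)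
  have f_fun: "function_on f (num (Suc N))"
    unfolding function_on_def by (auto simp: f mem_num less_Suc_eq_le)
  obtain h t' where run: "run M r N = (halt M, h, t')"
    using N(1) by (metis halts_at_def prod.collapse)
  obtain u where u: "maps u \<omega> (num 4)" "C N = pr (num (state_code qs (halt M))) (pr (num h) u)"
    "\<And>i. i \<le> b \<Longrightarrow> pr (num i) (num (sym_code (t' i))) \<epsilon> u"
    using C(1)[OF N(2)] by (auto simp: represents_def run)
  have "t' 1 = One" "t' 2 \<notin> {Zero, One}"
    using output_True_cells[OF M out N(1)] by (auto simp: run)
  have u1: "pr (num 1) (num 1) \<epsilon> u" using u(3)[of 1] N(3) \<open>t' 1 = One\<close> by simp
  have u2: "\<not> pr (num 2) (num k) \<epsilon> u" if "k < 2" for k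
  proof
    assume "pr (num 2) (num k) \<epsilon> u"
    \<comment> \<open>The tape \<open>u\<close> is single-valued and already carries the code of
      \<open>t' 2\<close> in this cell.\<close>
    then have "num k = num (sym_code (t' 2))"
      using u(1) u(3)[OF N(3)] unfolding maps_def function_on_def by blast
    then show False using that \<open>t' 2 \<notin> {Zero, One}\<close> by (cases "t' 2") auto
  qed
  have halted: "e' \<Turnstile> Halted_With_1 qs M y" if "e' y = C N" for e' y
    unfolding Halted_With_1_def using that u(2) u1 u2[of 0] u2[of 1] by simp
  have initial: "e' \<Turnstile> Initial_Config qs M w' x' y" if "e' w' = \<omega>" "e' x' = s" "e' y = C 0" for e' w' x' y
    unfolding Initial_Config_def using that t by (simp add: sat_Initial_Tape C(2) c0_def num_simps)
  have steps: "e' \<Turnstile> Step qs M w' x' y" if "e' w' = \<omega>" "e' x' = C i" "e' y = C (Suc i)" "i < N"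
    for e' w' x' y i
    using C(3)[of i] that N(2) unfolding stp_def by auto
  let ?e = "case_nat f (case_nat (num (Suc N)) (case_nat (num N) e))"
  have 1: "?e \<Turnstile> Succ 2 1" "?e \<Turnstile> Function 0 1"
    using f_fun by (simp_all add: num_simps(2))
  have 2: "?e \<Turnstile> Ex (Ex (Conj [Empty 1, App 2 1 0, Initial_Config qs M (w + 5) (x + 5) 0]))"
    unfolding sat_connectives
    by (rule bexI[where x = "num 0", OF _ UNIV_I], rule bexI[where x = "C 0", OF _ UNIV_I])
      (use f_app[of 0] initial ew ex in \<open>simp add: num_simps(1)\<close>)
  have 3: "?e \<Turnstile> BAll 2 (Ex (Ex (Ex (Conj
        [Succ 3 2, App 4 3 1, App 4 2 0, Step qs M (w + 7) 1 0]))))"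
  proof -
    have "case_nat (num i) ?e \<Turnstile> Ex (Ex (Ex (Conj
        [Succ 3 2, App 4 3 1, App 4 2 0, Step qs M (w + 7) 1 0])))" if "i < N" for i
      unfolding sat_connectives
      by (rule bexI[where x = "num (Suc i)", OF _ UNIV_I], rule bexI[where x = "C i", OF _ UNIV_I],
          rule bexI[where x = "C (Suc i)", OF _ UNIV_I])
        (use that f_app[of i] f_app[of "Suc i"] steps[OF _ _ _ that] ew in \<open>simp add: num_simps(2)\<close>)
    \<comment> \<open>The members of \<open>num N\<close> are exactly the numerals below
      \<open>N\<close>, so the bounded quantifier ranges over standard steps.\<close>
    moreover have e2: "?e 2 = num N" by simp
    ultimately show ?thesis unfolding sat_connectives(6) e2 mem_num by blast
  qed
  have 4: "?e \<Turnstile> Ex (And (App 1 3 0) (Halted_With_1 qs M 0))"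
    unfolding sat_connectives
    by (rule bexI[where x = "C N", OF _ UNIV_I]) (use f_app[of N] halted in simp)
  have "?e \<Turnstile> Conj
     [Succ 2 1, Function 0 1,
      Ex (Ex (Conj [Empty 1, App 2 1 0, Initial_Config qs M (w + 5) (x + 5) 0])),
      BAll 2 (Ex (Ex (Ex (Conj [Succ 3 2, App 4 3 1, App 4 2 0, Step qs M (w + 7) 1 0])))),
      Ex (And (App 1 3 0) (Halted_With_1 qs M 0))]"
    by (simp only: sat_Conj list.set ball_simps 1 2 3 4 simp_thms)
  then show ?thesis
    unfolding Outputs_1_def sat_connectives(5,7) ew using num_mem_omega by blast
qed

end

theorem theorem2p4:
  fixes M :: "'q tm" and K :: nat
  assumes "turing_machine M"
    and "halts_on_all_inputs M"
    and "\<forall>s :: bool list. length s \<ge> K \<longrightarrow> time_complexity M (length s) < length s"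
  shows "(\<forall>r :: bool list. length r \<ge> K \<longrightarrow> (\<exists>n<K. halts_at M r n)) \<and>
    ((\<forall>s :: bool list. length s \<le> K \<longrightarrow> outputs M s [True]) \<longrightarrow>
      (\<forall>qs. distinct qs \<and> set qs = states M \<longrightarrow> ZFC \<turnstile> all_outputs_1 qs M))"
proof (intro conjI allI impI)
  have K: "time_complexity M K < K"
    using assms(3)[rule_format, of "replicate K False"] by simp
  show halts: "\<exists>n<K. halts_at M r n" if "K \<le> length r" for r
    using halts_before_reading_tail[OF assms(2) K that] .
  fix qs
  assume out: "\<forall>s :: bool list. length s \<le> K \<longrightarrow> outputs M s [True]"
    and qs: "distinct qs \<and> set qs = states M"
  \<comment> \<open>With \<open>K = 1\<close> the machine would halt in 0 steps, so the start state
    would be halting and the empty input would leave cell 1 blank instead of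
    \<open>One\<close>.\<close>
  have "2 \<le> K"
  proof (rule ccontr)
    assume "\<not> 2 \<le> K"
    then have "K = 1" using K by linarith
    then have "halts_at M [] 0" using halts[of "[True]"] by (simp add: halts_at_def)
    then show False
      using output_True_cells(1)[OF assms(1), of "[]" 0] out by (simp add: initial_tape_def)
  qed
  show "ZFC \<turnstile> all_outputs_1 qs M"
  proof (rule ZFC_completeness)
    fix E :: "nat \<Rightarrow> nat \<Rightarrow> bool" and e
    assume "\<And>p e'. p \<in> ZFC \<Longrightarrow> sat UNIV E e' p"
    then interpret set_model E by unfold_locales
    obtain w where w: "is_omega w" using ex_omega by blast
    interpret omega_model E w using w by unfold_locales
    have "sat UNIV E (case_nat s (case_nat w e)) (Outputs_1 qs M 1 0)"
      if n: "E n w" and s: "maps s n (num 2)" for n s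
    proof -
      obtain r :: "bool list" where r: "length r \<le> K" "length r = K \<or> n = num (length r)"
        "\<And>j. j < length r \<Longrightarrow> E (num j) n \<and> (r ! j \<longleftrightarrow> E (pr (num j) (num 1)) s)"
        by (rule ex_standard_prefix[OF s n]; blast)
      \<comment> \<open>If \<open>r\<close> has length \<open>K\<close>, the first part gives
        \<open>N < K\<close>; otherwise \<open>r\<close> has the length of \<open>s\<close>, and any
        halting time will do.\<close>
      obtain N where N: "halts_at M r N" "n = num (length r) \<or> N < K"
        using r(2) halts[of r] assms(2) unfolding halts_on_all_inputs_def by blast
      \<comment> \<open>For equal lengths the tapes agree on all standard cells, so \<open>b\<close>
        may be as large as the run requires. Otherwise \<open>r\<close> has length \<open>K\<close>,
        and \<open>N < K\<close> and \<open>2 \<le> K\<close> permit \<open>b = K\<close>.\<close>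
      let ?b = "if n = num (length r) then max 2 N else K"
      show ?thesis
        by (rule sat_Outputs_1[where r = r and b = ?b and N = N and n = n and s = s])
          (use assms(1) qs s r N out \<open>2 \<le> K\<close> in auto)
    qed
    then show "sat UNIV E e (all_outputs_1 qs M)"
      using w by (auto simp: all_outputs_1_def intro!: exI[of _ w])
  qed
qed

end
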